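(* Let $\ell:\mathbb{R}^{n\times m}\to\mathbb{R}$ be twice differentiable, $K$-smooth and $\mu$-strongly convex with $\min_W\ell(W)=0$, let $h\ge\min\{m,n\}$, and let $L(W_1,W_2)=\ell(W_1W_2^\top)$ for $W_1\in\mathbb{R}^{n\times h}$, $W_2\in\mathbb{R}^{m\times h}$. Suppose gradient descent on $L$ is initialized at $(W_1(0),W_2(0))$ such that $\alpha_1>0$. Then there exists $\eta_{\max}>0$ such that for every $\eta_0$ with $0<\eta_0<\eta_{\max}$ and all step sizes $\eta_t$ satisfying, for every $t$, $$\eta_0\le\eta_t\le\min\Bigl((1+\eta_0^2)^{t/2}\eta_0,\ \frac1{K_t}\Bigr),$$ the following holds at each iteration $t\ge 0$: $$\bar\mu\le\mu_t\le K_t\le\bar K_t,\qquad L(t+1)\le L(t)\,\rho(\eta_t,t)\le L(t)\,\bar\rho(\eta_0,0),$$ and consequently gradient descent converges linearly: $$L(t+1)\le L(0)\,\bar\rho(\eta_0,0)^{t+1}.$$ Here $$\rho(\eta_t,t)=1-2\mu_t\eta_t+\mu_tK_t\eta_t^2,\qquad \bar\rho(\eta_t,t)=1-2\bar\mu\eta_t+\bar\mu\bar K_t\eta_t^2,$$ $$\bar\mu=\mu\bigl[\alpha_1+2\alpha_2\bigl(1-\exp(\sqrt{\eta_0})\bigr)\bigr],\qquad \Delta=(1+\eta_0^2)\,\bar\rho(\eta_0,0),$$ $$\bar K_t=\sqrt{2KL(0)\bar\rho(\eta_0,0)^t}+6K^2\beta_2L(0)\eta_0^2\Delta^t+K\e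xp(\sqrt{\eta_0})\,\alpha_2\bigl[1+3\sqrt{2KL(0)\Delta^t}\,\eta_0\bigr].$$
   Context: Gradient descent: $W_1(t+1)=W_1(t)-\eta_t\nabla\ell(W(t))W_2(t)$ and $W_2(t+1)=W_2(t)-\eta_t\nabla\ell(W(t))^\top W_1(t)$, where $W(t)=W_1(t)W_2(t)^\top$. Write $L(t)=L(W_1(t),W_2(t))$. $K$-smooth means $\ell(V)\le \ell(W)+\langle\nabla\ell(W),V-W\rangle+\frac K2\|V-W\|_F^2$ for all $V,W$. For fixed $(W_1,W_2)$, $\mathcal{T}(\,\cdot\,;W_1,W_2):\mathbb{R}^{n\times m}\to\mathbb{R}^{(n+m)\times h}$ is the linear operator $U\mapsto \begin{bmatrix}UW_2\\ U^\top W_1\end{bmatrix}$; $\mathcal{T}_t=\mathcal{T}(\,\cdot\,;W_1(t),W_2(t))$; $\sigma_{\max}^2(\mathcal{T}),\sigma_{\min}^2(\mathcal{T})$ are the largest and smallest eigenvalues of $\mathcal{T}^*\circ\mathcal{T}$. The local constants are $$\mu_t=\mu\,\sigma_{\min}^2(\mathcal{T}_t),\quad K_t = K\sigma_{\max}^2(\mathcal{T}_t)+\sqrt{2KL(t)}+6K^2\sigma_{\max}(W(t))L(t)\eta_t^2+3K\sigma_{\max}^2(\mathcal{T}_t)\sqrt{2KL(t)}\,\eta_t$$ (so $K_t$ itself depends on $\eta_t$). Let $W^*$ be the minimizer of $\ell$; $\sigma_{\max}(A),\sigma_{\min}(A)$ denote the largest and smallest singular values of a matrix $A$, and $\lambda_i(A)$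 the $i$-th largest eigenvalue of a symmetric matrix $A$. Let $D(0)=W_1(0)^\top W_1(0)-W_2(0)^\top W_2(0)\in\mathbb{R}^{h\times h}$ and $$\lambda_-=\max(\lambda_{\max}(-D(0)),0),\qquad \lambda_+=\max(\lambda_{\max}(D(0)),0),$$ $$\underline{\Delta}=\max(\lambda_n(D(0)),0)+\max(\lambda_m(-D(0)),0),$$ $$\Delta_+=\lambda_+-\max(\lambda_n(D(0)),0),\qquad \Delta_-=\lambda_--\max(\lambda_m(-D(0)),0)$$ (a term $\max(\lambda_i(\cdot),0)$ with $i>h$ is read as $0$), $$\beta_1=\max\Bigl(0,\ \sigma_{\min}(W^* )-\sqrt{\tfrac K\mu}\,\|W(0)-W^*\|_F\Bigr),\qquad \beta_2=\sigma_{\max}(W^* )+\sqrt{\tfrac K\mu}\,\|W(0)-W^*\|_F,$$ $$\alpha_1=\frac{-\Delta_+-\Delta_-+\sqrt{(\Delta_++\underline{\Delta})^2+4\beta_1^2}+\sqrt{(\Delta_-+\underline{\Delta})^2+4\beta_1^2}}{2},$$ $$\alpha_2=\frac{\lambda_++\sqrt{\lambda_+^2+4\beta_2^2}}{2}+\frac{\lambda_-+\sqrt{\lambda_-^2+4\beta_2^2}}{2}.$$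
   Formalization: For n ≠ m, the smallest singular value of W* is taken to be 0 (so β₁ = 0), because with the usual smallest of min(n,m) singular values the bound μ̄ ≤ μ_t fails, e.g. n = h = 1, m = 2, W₁ = (a), W₂ = (b,0)ᵀ, a > b > 0, W* = W₁W₂ᵀ. *)

theory Defs
  imports "HOL-Analysis.Analysis" "HOL-Library.Multiset"
begin

text \<open>
  Matrices of size n x m are \<open>real ^ 'm ^ 'n\<close>. The library inner product and norm on this type
  are the Frobenius inner product and the Frobenius norm.
\<close>

section \<open>Eigenvalues and singular values\<close>

definition eigenvalues :: "('a::euclidean_space \<Rightarrow> 'a) \<Rightarrow> real set" where
  "eigenvalues f = {c. \<exists>x. x \<noteq> 0 \<and> f x = c *\<^sub>R x}"

text \<open>
  All eigenvalues in decreasing order, repeated according to (geometric) multiplicity.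
  Used for self-adjoint maps only, for which the list has length \<open>DIM('a)\<close>.
\<close>

definition eigenvalue_list :: "('a::euclidean_space \<Rightarrow> 'a) \<Rightarrow> real list" where
  "eigenvalue_list f = rev (sorted_list_of_multiset
     (\<Sum>c\<in>eigenvalues f. replicate_mset (dim {x. f x = c *\<^sub>R x}) c))"

definition mat_eigenvalues :: "real ^ 'k ^ 'k \<Rightarrow> real set" where
  "mat_eigenvalues S = eigenvalues ((*v) S)"

definition lambda_max :: "real ^ 'k ^ 'k \<Rightarrow> real" where
  "lambda_max S = Max (mat_eigenvalues S)"

text \<open>The i-th largest eigenvalue of a symmetric matrix, with \<open>1 \<le> i \<le> CARD('k)\<close>.\<close>

definition lambda_nth :: "nat \<Rightarrow> real ^ 'k ^ 'k \<Rightarrow> real" where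
  "lambda_nth i S = eigenvalue_list ((*v) S) ! (i - 1)"

text \<open>\<open>max (\<lambda>\<^sub>i(S), 0)\<close>, read as 0 when i exceeds the size of S.\<close>

definition lambda_nth_pos :: "nat \<Rightarrow> real ^ 'k ^ 'k \<Rightarrow> real" where
  "lambda_nth_pos i S = (if i \<le> CARD('k) then max (lambda_nth i S) 0 else 0)"

definition sigma_max :: "real ^ 'm ^ 'n \<Rightarrow> real" where
  "sigma_max M = sqrt (Max (mat_eigenvalues (transpose M ** M)))"

text \<open>
  Convention for rectangular matrices: the n x m matrix M is regarded as having \<open>max n m\<close>
  singular values, those beyond the \<open>min n m\<close>-th being 0. Both Gram matrices are therefore
  consulted. For n = m they have the same spectrum and this is the usual smallest singular value;
  for \<open>n \<noteq> m\<close> it is 0. Counting only \<open>min n m\<close> singular values would make the lower bound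
  \<open>\<alpha>\<^sub>1\<close> for \<open>\<sigma>\<^sub>m\<^sub>i\<^sub>n\<^sup>2\<close> of the operator \<open>\<T>\<close> false: take n = h = 1, m = 2, W1 = (a),
  W2 = (b, 0) with a > b > 0 and W* = W1 W2^T. Then \<open>\<alpha>\<^sub>1\<close> would be \<open>a\<^sup>2 + b\<^sup>2\<close>, but the
  smallest eigenvalue of \<open>\<T>* \<circ> \<T>\<close> is \<open>a\<^sup>2\<close>.
\<close>

definition sigma_min :: "real ^ 'm ^ 'n \<Rightarrow> real" where
  "sigma_min M = sqrt (min (Min (mat_eigenvalues (transpose M ** M)))
                           (Min (mat_eigenvalues (M ** transpose M))))"


section \<open>Assumptions on the loss\<close>

definition gradient :: "('a::real_inner \<Rightarrow> real) \<Rightarrow> 'a \<Rightarrow> 'a" where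
  "gradient l W = (THE D. GDERIV l W :> D)"

definition twice_differentiable :: "('a::real_inner \<Rightarrow> real) \<Rightarrow> bool" where
  "twice_differentiable l \<longleftrightarrow>
     (\<forall>W. l differentiable (at W)) \<and> (\<forall>W. gradient l differentiable (at W))"

definition smooth_const :: "real \<Rightarrow> ('a::real_inner \<Rightarrow> real) \<Rightarrow> bool" where
  "smooth_const K l \<longleftrightarrow>
     (\<forall>V W. l V \<le> l W + gradient l W \<bullet> (V - W) + K / 2 * (norm (V - W))\<^sup>2)"

definition strongly_convex :: "real \<Rightarrow> ('a::real_inner \<Rightarrow> real) \<Rightarrow> bool" where
  "strongly_convex \<mu> l \<longleftrightarrow> 0 < \<mu> \<and>
     (\<forall>V W. l V \<ge> l W + gradient l W \<bullet> (V - W) + \<mu> / 2 * (norm (V - W))\<^sup>2)"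


section \<open>Gradient descent on the factorized loss\<close>

primrec gd :: "(real ^ 'm ^ 'n \<Rightarrow> real) \<Rightarrow> (nat \<Rightarrow> real) \<Rightarrow> real ^ 'h ^ 'n \<Rightarrow> real ^ 'h ^ 'm
    \<Rightarrow> nat \<Rightarrow> (real ^ 'h ^ 'n) \<times> (real ^ 'h ^ 'm)" where
  "gd l \<eta> A B 0 = (A, B)"
| "gd l \<eta> A B (Suc t) =
     (let (W1, W2) = gd l \<eta> A B t; G = gradient l (W1 ** transpose W2)
      in (W1 - \<eta> t *\<^sub>R (G ** W2), W2 - \<eta> t *\<^sub>R (transpose G ** W1)))"

definition W1 where "W1 l \<eta> A B t = fst (gd l \<eta> A B t)"
definition W2 where "W2 l \<eta> A B t = snd (gd l \<eta> A B t)"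
definition Wprod where "Wprod l \<eta> A B t = W1 l \<eta> A B t ** transpose (W2 l \<eta> A B t)"
definition factored_loss ::
    "(real ^ 'm ^ 'n \<Rightarrow> real) \<Rightarrow> real ^ 'h ^ 'n \<Rightarrow> real ^ 'h ^ 'm \<Rightarrow> real" where
  "factored_loss l A B = l (A ** transpose B)"
definition loss where "loss l \<eta> A B t = factored_loss l (W1 l \<eta> A B t) (W2 l \<eta> A B t)"

text \<open>The block matrix with upper block \<open>U W\<^sub>2\<close> and lower block \<open>U\<^sup>T W\<^sub>1\<close>.\<close>

definition T_op :: "real ^ 'h ^ 'n \<Rightarrow> real ^ 'h ^ 'm \<Rightarrow> real ^ 'm ^ 'n \<Rightarrow> real ^ 'h ^ ('n + 'm)" where
  "T_op A B U = (\<chi> i. case i of Inl a \<Rightarrow> (U ** B) $ a | Inr b \<Rightarrow> (transpose U ** A) $ b)"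

definition sigma_max_sq_T where
  "sigma_max_sq_T A B = Max (eigenvalues (adjoint (T_op A B) \<circ> T_op A B))"
definition sigma_min_sq_T where
  "sigma_min_sq_T A B = Min (eigenvalues (adjoint (T_op A B) \<circ> T_op A B))"

definition mu_loc where
  "mu_loc l \<mu> \<eta> A B t = \<mu> * sigma_min_sq_T (W1 l \<eta> A B t) (W2 l \<eta> A B t)"

definition K_loc where
  "K_loc l K \<eta> A B t =
     (let s = sigma_max_sq_T (W1 l \<eta> A B t) (W2 l \<eta> A B t); Lt = loss l \<eta> A B t
      in K * s + sqrt (2 * K * Lt)
         + 6 * K\<^sup>2 * sigma_max (Wprod l \<eta> A B t) * Lt * (\<eta> t)\<^sup>2
         + 3 * K * s * sqrt (2 * K * Lt) * \<eta> t)"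

definition rho where
  "rho l K \<mu> \<eta> A B t =
     1 - 2 * mu_loc l \<mu> \<eta> A B t * \<eta> t + mu_loc l \<mu> \<eta> A B t * K_loc l K \<eta> A B t * (\<eta> t)\<^sup>2"


section \<open>Constants determined by the initialization\<close>

definition imbalance :: "real ^ 'h ^ 'n \<Rightarrow> real ^ 'h ^ 'm \<Rightarrow> real ^ 'h ^ 'h" where
  "imbalance A B = transpose A ** A - transpose B ** B"

definition lambda_minus where
  "lambda_minus A B = max (lambda_max (- imbalance A B)) 0"

definition lambda_plus where
  "lambda_plus A B = max (lambda_max (imbalance A B)) 0"

definition Delta_low :: "real ^ 'h ^ 'n \<Rightarrow> real ^ 'h ^ 'm \<Rightarrow> real" where
  "Delta_low A B = lambda_nth_pos CARD('n) (imbalance A B)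
                 + lambda_nth_pos CARD('m) (- imbalance A B)"

definition Delta_plus :: "real ^ 'h ^ 'n \<Rightarrow> real ^ 'h ^ 'm \<Rightarrow> real" where
  "Delta_plus A B = lambda_plus A B - lambda_nth_pos CARD('n) (imbalance A B)"

definition Delta_minus :: "real ^ 'h ^ 'n \<Rightarrow> real ^ 'h ^ 'm \<Rightarrow> real" where
  "Delta_minus A B = lambda_minus A B - lambda_nth_pos CARD('m) (- imbalance A B)"

definition beta1 where
  "beta1 K \<mu> A B Wstar =
     max 0 (sigma_min Wstar - sqrt (K / \<mu>) * norm (A ** transpose B - Wstar))"

definition beta2 where
  "beta2 K \<mu> A B Wstar =
     sigma_max Wstar + sqrt (K / \<mu>) * norm (A ** transpose B - Wstar)"

definition alpha1 where
  "alpha1 K \<mu> A B Wstar =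
     (- Delta_plus A B - Delta_minus A B
      + sqrt ((Delta_plus A B + Delta_low A B)\<^sup>2 + 4 * (beta1 K \<mu> A B Wstar)\<^sup>2)
      + sqrt ((Delta_minus A B + Delta_low A B)\<^sup>2 + 4 * (beta1 K \<mu> A B Wstar)\<^sup>2)) / 2"

definition alpha2 where
  "alpha2 K \<mu> A B Wstar =
     (lambda_plus A B + sqrt ((lambda_plus A B)\<^sup>2 + 4 * (beta2 K \<mu> A B Wstar)\<^sup>2)) / 2
     + (lambda_minus A B + sqrt ((lambda_minus A B)\<^sup>2 + 4 * (beta2 K \<mu> A B Wstar)\<^sup>2)) / 2"

definition mu_bar where
  "mu_bar K \<mu> A B Wstar \<eta>0 =
     \<mu> * (alpha1 K \<mu> A B Wstar + 2 * alpha2 K \<mu> A B Wstar * (1 - exp (sqrt \<eta>0)))"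

text \<open>
  \<open>K_bar t\<close> is defined through \<open>\<rho>_bar(\<eta>0, 0)\<close>, which in turn uses \<open>K_bar 0\<close>. There is no
  circularity since at t = 0 the powers of \<open>\<rho>_bar(\<eta>0, 0)\<close> and \<open>\<Delta>\<close> equal 1. So the formula for
  \<open>K_bar t\<close> is first stated with the value r of \<open>\<rho>_bar(\<eta>0, 0)\<close> as a parameter, and at t = 0 the
  choice of r is immaterial. The intended mutual equations are \<open>K_bar_eq\<close> and \<open>rho_bar_def\<close>.
\<close>

definition K_bar_of where
  "K_bar_of r l K \<mu> A B Wstar \<eta>0 t =
     (let L0 = factored_loss l A B; \<Delta> = (1 + \<eta>0\<^sup>2) * r
      in sqrt (2 * K * L0 * r ^ t)
         + 6 * K\<^sup>2 * beta2 K \<mu> A B Wstar * L0 * \<eta>0\<^sup>2 * \<Delta> ^ t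
         + K * exp (sqrt \<eta>0) * alpha2 K \<mu> A B Wstar * (1 + 3 * sqrt (2 * K * L0 * \<Delta> ^ t) * \<eta>0))"

definition K_bar where
  "K_bar l K \<mu> A B Wstar \<eta>0 t =
     K_bar_of (1 - 2 * mu_bar K \<mu> A B Wstar \<eta>0 * \<eta>0
               + mu_bar K \<mu> A B Wstar \<eta>0 * K_bar_of 1 l K \<mu> A B Wstar \<eta>0 0 * \<eta>0\<^sup>2)
       l K \<mu> A B Wstar \<eta>0 t"

text \<open>\<open>\<rho>_bar(x, t)\<close>; the parameter \<open>\<eta>0\<close> enters through \<open>mu_bar\<close> and \<open>K_bar\<close>.\<close>

definition rho_bar where
  "rho_bar l K \<mu> A B Wstar \<eta>0 x t =
     1 - 2 * mu_bar K \<mu> A B Wstar \<eta>0 * x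
       + mu_bar K \<mu> A B Wstar \<eta>0 * K_bar l K \<mu> A B Wstar \<eta>0 t * x\<^sup>2"

lemma K_bar_eq:
  "K_bar l K \<mu> A B Wstar \<eta>0 t =
     (let L0 = factored_loss l A B; r = rho_bar l K \<mu> A B Wstar \<eta>0 \<eta>0 0; \<Delta> = (1 + \<eta>0\<^sup>2) * r
      in sqrt (2 * K * L0 * r ^ t)
         + 6 * K\<^sup>2 * beta2 K \<mu> A B Wstar * L0 * \<eta>0\<^sup>2 * \<Delta> ^ t
         + K * exp (sqrt \<eta>0) * alpha2 K \<mu> A B Wstar * (1 + 3 * sqrt (2 * K * L0 * \<Delta> ^ t) * \<eta>0))"
proof -
  have "K_bar_of r l K \<mu> A B Wstar \<eta>0 0 = K_bar_of 1 l K \<mu> A B Wstar \<eta>0 0" for r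
    by (simp add: K_bar_of_def)
  then have "rho_bar l K \<mu> A B Wstar \<eta>0 \<eta>0 0 =
      1 - 2 * mu_bar K \<mu> A B Wstar \<eta>0 * \<eta>0
        + mu_bar K \<mu> A B Wstar \<eta>0 * K_bar_of 1 l K \<mu> A B Wstar \<eta>0 0 * \<eta>0\<^sup>2"
    unfolding rho_bar_def K_bar_def by simp
  then show ?thesis
    unfolding K_bar_def K_bar_of_def by (simp only: Let_def)
qed

end

theory Submission
  imports Defs
begin

text \<open>
  The descent lemma along one step gives \<open>L(t+1) \<le> L(t) \<rho>(\<eta>\<^sub>t, t)\<close> from smoothness, and the
  Polyak-Lojasiewicz inequality from strong convexity, with \<open>\<sigma>\<^sub>m\<^sub>i\<^sub>n\<^sup>2\<close> and \<open>\<sigma>\<^sub>m\<^sub>a\<^sub>x\<^sup>2\<close> of the current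
  operator \<open>\<T>\<^sub>t\<close>. These two are controlled through the imbalance \<open>D(t) = W\<^sub>1\<^sup>T W\<^sub>1 - W\<^sub>2\<^sup>T W\<^sub>2\<close>: gradient flow
  would preserve it, and a gradient step changes it only by \<open>O(\<eta>\<^sub>t\<^sup>2 L(t))\<close>. As \<open>L(t)\<close> decays like
  \<open>\<rho>\<^sub>0\<^sup>t\<close> while \<open>\<eta>\<^sub>t\<^sup>2\<close> grows at most like \<open>(1 + \<eta>\<^sub>0\<^sup>2)\<^sup>t\<close>, the total drift is a geometric sum of ratio
  \<open>\<Delta> = 1 - \<Omega>(\<eta>\<^sub>0)\<close>, hence \<open>O(\<eta>\<^sub>0)\<close>, which the slack \<open>exp (sqrt \<eta>\<^sub>0) - 1\<close> in the constants absorbs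
  for small \<open>\<eta>\<^sub>0\<close>. Since \<open>L(t) \<le> L(0)\<close> also keeps \<open>W(t)\<close> within the distance to \<open>W\<^sup>*\<close> that enters
  \<open>\<beta>\<^sub>1\<close> and \<open>\<beta>\<^sub>2\<close>, all bounds follow by a single induction on \<open>t\<close>.
\<close>

section \<open>Spectral theory of self-adjoint maps\<close>

definition self_adjoint :: "('a::real_inner \<Rightarrow> 'a) \<Rightarrow> bool" where
  "self_adjoint f \<longleftrightarrow> linear f \<and> (\<forall>x y. f x \<bullet> y = x \<bullet> f y)"

lemma self_adjoint_uminus: "self_adjoint f \<Longrightarrow> self_adjoint (\<lambda>x. - f x)"
  by (auto simp: self_adjoint_def linear_compose_neg)

text \<open>A zero of a nonnegative form is a minimum: if \<open>q x\<close> were nonzero, a short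
  move from \<open>x\<close> along \<open>- q x\<close>, which stays in the invariant
  \<open>S\<close>, would make the form negative to first order.\<close>

lemma psd_form_zero_imp:
  fixes q :: "'a::real_inner \<Rightarrow> 'a"
  assumes q: "self_adjoint q" and S: "subspace S" "q ` S \<subseteq> S"
    and psd: "\<And>y. y \<in> S \<Longrightarrow> 0 \<le> y \<bullet> q y"
    and x: "x \<in> S" "x \<bullet> q x = 0"
  shows "q x = 0"
proof (rule ccontr)
  assume "q x \<noteq> 0"
  define v where "v = q x"
  have lin: "linear q" and sa: "\<And>x y. q x \<bullet> y = x \<bullet> q y" using q by (auto simp: self_adjoint_def)
  have vS: "v \<in> S" using S x v_def by auto
  define a b where "a = v \<bullet> v" and "b = v \<bullet> q v"
  have a: "a > 0" using \<open>q x \<noteq> 0\<close> by (simp add: a_def v_def)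
  have b: "b \<ge> 0" using psd[OF vS] by (simp add: b_def)
  \<comment> \<open>Chosen so that \<open>s * b < a\<close>; the form at the moved point is
    \<open>s * (s * b - 2 * a)\<close>, hence negative.\<close>
  define s where "s = a / (b + 1)"
  have s: "s > 0" "s * b < a" using a b by (auto simp: s_def field_simps)
  have "0 \<le> (x - s *\<^sub>R v) \<bullet> q (x - s *\<^sub>R v)"
    using psd S x vS by (simp add: subspace_diff subspace_scale)
  also have "\<dots> = s * (s * b - 2 * a)"
    using x(2) sa[of x v] by (simp add: linear_diff[OF lin] linear_scale[OF lin] inner_simps a_def b_def v_def
        algebra_simps inner_commute)
  also have "\<dots> < 0" using s a by (intro mult_pos_neg) auto
  finally show False by simp
qed

text \<open>At a maximizer of the form on the unit sphere of \<open>S\<close>, the form of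
  \<open>c - f\<close> is nonnegative on \<open>S\<close> and vanishes, so
  \<open>psd_form_zero_imp\<close> gives the eigenvector equation. Stated on subspaces, it serves
  orthogonal complements and, through \<open>- f\<close>, least eigenvalues.\<close>

lemma self_adjoint_top_eigenvector:
  fixes f :: "'a::euclidean_space \<Rightarrow> 'a"
  assumes f: "self_adjoint f" and S: "subspace S" "f ` S \<subseteq> S" "S \<noteq> {0}"
  obtains x c where "x \<in> S" "x \<noteq> 0" "f x = c *\<^sub>R x" "\<And>y. y \<in> S \<Longrightarrow> y \<bullet> f y \<le> c * (norm y)\<^sup>2"
proof -
  have lin: "linear f" and sa: "\<And>x y. f x \<bullet> y = x \<bullet> f y" using f by (auto simp: self_adjoint_def)
  let ?B = "S \<inter> sphere 0 1"
  have "compact ?B" using closed_subspace[OF S(1)] by (simp add: closed_Int_compact)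
  obtain z where z: "z \<in> S" "z \<noteq> 0" using S subspace_0 by blast
  have "(1 / norm z) *\<^sub>R z \<in> ?B" using z S(1) by (simp add: subspace_scale)
  moreover have "continuous_on ?B (\<lambda>y. y \<bullet> f y)"
    using lin by (intro continuous_intros linear_continuous_on linear_conv_bounded_linear[THEN iffD1])
  ultimately obtain x where x: "x \<in> ?B" "\<And>y. y \<in> ?B \<Longrightarrow> y \<bullet> f y \<le> x \<bullet> f x"
    using continuous_attains_sup[OF \<open>compact ?B\<close>, of "\<lambda>y. y \<bullet> f y"] by blast
  define c where "c = x \<bullet> f x"
  have up: "y \<bullet> f y \<le> c * (norm y)\<^sup>2" if "y \<in> S" for y
  proof (cases "y = 0")
    case False
    have "(1 / norm y) *\<^sub>R y \<in> ?B" using that False S(1) by (simp add: subspace_scale)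
    from x(2)[OF this] show ?thesis using False
      by (simp add: linear_scale[OF lin] c_def power2_eq_square field_simps)
  qed (use lin in \<open>simp add: linear_0\<close>)
  let ?q = "\<lambda>y. c *\<^sub>R y - f y"
  have "?q x = 0"
  proof (rule psd_form_zero_imp[where q = ?q, OF _ S(1)])
    show "self_adjoint ?q"
      unfolding self_adjoint_def
      using sa by (auto simp: inner_simps linear_iff linear_add[OF lin] linear_scale[OF lin] algebra_simps)
    show "?q ` S \<subseteq> S" using S by (auto intro!: subspace_diff subspace_scale)
    show "0 \<le> y \<bullet> ?q y" if "y \<in> S" for y using up[OF that] by (simp add: inner_simps power2_norm_eq_inner)
    show "x \<bullet> ?q x = 0" using x(1) by (simp add: inner_simps c_def flip: power2_norm_eq_inner)
  qed (use x in simp)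
  moreover have "x \<noteq> 0" using x(1) by auto
  ultimately show thesis using that[of x c] x(1) up by auto
qed

lemma eigenspace_orthogonal:
  assumes "self_adjoint f" "f x = c *\<^sub>R x" "f y = d *\<^sub>R y" "c \<noteq> d"
  shows "x \<bullet> y = 0"
proof -
  have "c * (x \<bullet> y) = d * (x \<bullet> y)"
    using assms unfolding self_adjoint_def by (metis inner_scaleR_left inner_scaleR_right)
  then show ?thesis using assms(4) by simp
qed

text \<open>One eigenvector chosen per eigenvalue gives a pairwise orthogonal set, which is finite;
  orthogonality also makes the choice injective.\<close>

lemma finite_eigenvalues:
  fixes f :: "'a::euclidean_space \<Rightarrow> 'a"
  assumes "self_adjoint f"
  shows "finite (eigenvalues f)"
proof -
  define e where "e c = (SOME x. x \<noteq> 0 \<and> f x = c *\<^sub>R x)" for c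
  have e: "e c \<noteq> 0 \<and> f (e c) = c *\<^sub>R e c" if "c \<in> eigenvalues f" for c
    unfolding e_def by (rule someI_ex) (use that in \<open>auto simp: eigenvalues_def\<close>)
  have orth: "e c \<bullet> e d = 0" if "c \<in> eigenvalues f" "d \<in> eigenvalues f" "c \<noteq> d" for c d
    using eigenspace_orthogonal[OF assms _ _ that(3)] e that by blast
  have "inj_on e (eigenvalues f)"
    using orth e by (metis inj_onI inner_eq_zero_iff)
  moreover have "finite (e ` eigenvalues f)"
    by (intro pairwise_orthogonal_imp_finite) (auto simp: pairwise_def orthogonal_def intro!: orth)
  ultimately show ?thesis using finite_imageD by blast
qed

lemma UNIV_euclidean_neq_0: "(UNIV :: 'a::euclidean_space set) \<noteq> {0}"
  by (metis SOME_Basis UNIV_I nonzero_Basis singletonD)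

lemma Max_eigenvalues:
  fixes f :: "'a::euclidean_space \<Rightarrow> 'a"
  assumes "self_adjoint f"
  shows "Max (eigenvalues f) \<in> eigenvalues f" "x \<bullet> f x \<le> Max (eigenvalues f) * (norm x)\<^sup>2"
proof -
  obtain z c where z: "z \<noteq> 0" "f z = c *\<^sub>R z" "\<And>y. y \<bullet> f y \<le> c * (norm y)\<^sup>2"
    using self_adjoint_top_eigenvector[OF assms subspace_UNIV _ UNIV_euclidean_neq_0] by auto
  then have c: "c \<in> eigenvalues f" by (auto simp: eigenvalues_def)
  then show "Max (eigenvalues f) \<in> eigenvalues f" using finite_eigenvalues[OF assms] by (intro Max_in) auto
  have "x \<bullet> f x \<le> c * (norm x)\<^sup>2" by (fact z)
  also have "\<dots> \<le> Max (eigenvalues f) * (norm x)\<^sup>2"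
    using c finite_eigenvalues[OF assms] by (intro mult_right_mono) auto
  finally show "x \<bullet> f x \<le> Max (eigenvalues f) * (norm x)\<^sup>2" .
qed

lemma Min_eigenvalues:
  fixes f :: "'a::euclidean_space \<Rightarrow> 'a"
  assumes "self_adjoint f"
  shows "Min (eigenvalues f) \<in> eigenvalues f" "Min (eigenvalues f) * (norm x)\<^sup>2 \<le> x \<bullet> f x"
proof -
  obtain z c where z: "z \<noteq> 0" "- f z = c *\<^sub>R z" "\<And>y. y \<bullet> - f y \<le> c * (norm y)\<^sup>2"
    using self_adjoint_top_eigenvector[OF self_adjoint_uminus[OF assms] subspace_UNIV _ UNIV_euclidean_neq_0] by auto
  have "f z = - c *\<^sub>R z" using z(2) by (metis minus_minus scaleR_minus_left)
  with z(1) have c: "- c \<in> eigenvalues f" unfolding eigenvalues_def by blast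
  then show "Min (eigenvalues f) \<in> eigenvalues f" using finite_eigenvalues[OF assms] by (intro Min_in) auto
  have "Min (eigenvalues f) * (norm x)\<^sup>2 \<le> - c * (norm x)\<^sup>2"
    using c finite_eigenvalues[OF assms] by (intro mult_right_mono) auto
  also have "\<dots> \<le> x \<bullet> f x" using z(3)[of x] by simp
  finally show "Min (eigenvalues f) * (norm x)\<^sup>2 \<le> x \<bullet> f x" .
qed

section \<open>Completeness of the eigenspaces and the ordered eigenvalue list\<close>

lemma dim_sum_eigenspaces:
  fixes f :: "'a::euclidean_space \<Rightarrow> 'a"
  assumes "self_adjoint f" "finite F"
  shows "dim (\<Union>c\<in>F. {x. f x = c *\<^sub>R x}) = (\<Sum>c\<in>F. dim {x. f x = c *\<^sub>R x})"
  using assms(2)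
proof (induction F)
  case (insert c F)
  have "dim ({x. f x = c *\<^sub>R x} \<union> (\<Union>d\<in>F. {x. f x = d *\<^sub>R x}))
      = dim {x. f x = c *\<^sub>R x} + dim (\<Union>d\<in>F. {x. f x = d *\<^sub>R x})"
    using insert.hyps by (intro dim_orthogonal_sum) (auto intro!: eigenspace_orthogonal[OF assms(1)])
  then show ?case using insert by simp
qed auto

lemma span_eigenspaces_invariant:
  fixes f :: "'a::euclidean_space \<Rightarrow> 'a"
  assumes "linear f"
  shows "f ` span (\<Union>c\<in>F. {x. f x = c *\<^sub>R x}) \<subseteq> span (\<Union>c\<in>F. {x. f x = c *\<^sub>R x})"
proof -
  let ?U = "\<Union>c\<in>F. {x. f x = c *\<^sub>R x}"
  have "f y \<in> span ?U" if "c \<in> F" "f y = c *\<^sub>R y" for c y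
    unfolding that(2) using that by (intro span_scale span_base) auto
  then have "f ` ?U \<subseteq> span ?U" by auto
  then show ?thesis by (simp add: span_linear_image[OF assms, symmetric] span_minimal)
qed

lemma orthogonal_comp_invariant:
  assumes "self_adjoint f" "f ` S \<subseteq> S"
  shows "f ` {y. \<forall>x\<in>S. x \<bullet> y = 0} \<subseteq> {y. \<forall>x\<in>S. x \<bullet> y = 0}"
proof safe
  fix y x assume y: "\<forall>x\<in>S. x \<bullet> y = 0" and "x \<in> S"
  then have "f x \<bullet> y = 0" using assms(2) by blast
  then show "x \<bullet> f y = 0" using assms(1) by (simp add: self_adjoint_def)
qed

lemma subspace_orthogonal_set: "subspace {y. \<forall>x\<in>S. x \<bullet> y = 0}"
  by (auto simp: subspace_def inner_simps)

text \<open>The orthogonal complement of the span is invariant. If nonzero, it would contain an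
  eigenvector, which also lies in the span and so is orthogonal to itself.\<close>

lemma span_all_eigenspaces:
  fixes f :: "'a::euclidean_space \<Rightarrow> 'a"
  assumes f: "self_adjoint f"
  shows "span (\<Union>c\<in>eigenvalues f. {x. f x = c *\<^sub>R x}) = UNIV"
proof (rule ccontr)
  let ?S = "span (\<Union>c\<in>eigenvalues f. {x. f x = c *\<^sub>R x})"
  assume ne: "?S \<noteq> UNIV"
  let ?T = "{y. \<forall>x\<in>?S. x \<bullet> y = 0}"
  have lin: "linear f" using f by (simp add: self_adjoint_def)
  have "span ?S \<subset> span UNIV" using ne by (metis real_vector.span_span real_vector.span_UNIV psubsetI subset_UNIV)
  then obtain a where a: "a \<noteq> 0" "\<And>y. y \<in> span ?S \<Longrightarrow> orthogonal a y"
    using orthogonal_to_subspace_exists_gen[of ?S UNIV] by metis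
  have inv: "f ` ?T \<subseteq> ?T"
    by (rule orthogonal_comp_invariant[OF f span_eigenspaces_invariant[OF lin]])
  have "a \<in> ?T" using a(2)[OF span_base] by (auto simp: orthogonal_def inner_commute)
  then have "?T \<noteq> {0}" using a(1) by blast
  then obtain x c where x: "x \<in> ?T" "x \<noteq> 0" "f x = c *\<^sub>R x"
    by (rule self_adjoint_top_eigenvector[OF f subspace_orthogonal_set inv])
  have "c \<in> eigenvalues f" using x(2,3) unfolding eigenvalues_def by blast
  then have "x \<in> ?S" using x(3) by (intro span_base) blast
  then have "x \<bullet> x = 0" using x(1) by blast
  with x(2) show False by simp
qed

lemma size_sum_mset: "finite F \<Longrightarrow> size (\<Sum>c\<in>F. g c :: 'b multiset) = (\<Sum>c\<in>F. size (g c))"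
  by (induction F rule: finite_induct) auto

lemma filter_sum_mset: "finite F \<Longrightarrow> filter_mset P (\<Sum>c\<in>F. g c :: 'b multiset) = (\<Sum>c\<in>F. filter_mset P (g c))"
  by (induction F rule: finite_induct) auto

lemma size_filter_replicate_mset: "size (filter_mset P (replicate_mset k x)) = (if P x then k else 0)"
  by (induction k) auto

text \<open>Turns a position in a decreasing list into a count with multiplicity: the entries at
  positions 0 to \<open>i\<close> all pass the filter.\<close>

lemma length_filter_ge_sorted_desc:
  assumes "sorted (rev xs)" "i < length xs"
  shows "Suc i \<le> length (filter (\<lambda>d. xs ! i \<le> d) xs)"
proof -
  have "\<forall>d\<in>set (take (Suc i) xs). xs ! i \<le> d"
    using assms by (auto simp: in_set_conv_nth sorted_rev_iff_nth_mono)
  then have "filter (\<lambda>d. xs ! i \<le> d) (take (Suc i) xs) = take (Suc i) xs" by (simp add: filter_id_conv)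
  then have "length (filter (\<lambda>d. xs ! i \<le> d) (take (Suc i) xs)) = Suc i" using assms(2) by simp
  moreover have "filter (\<lambda>d. xs ! i \<le> d) xs
      = filter (\<lambda>d. xs ! i \<le> d) (take (Suc i) xs) @ filter (\<lambda>d. xs ! i \<le> d) (drop (Suc i) xs)"
    by (metis append_take_drop_id filter_append)
  ultimately show ?thesis by simp
qed

text \<open>The existence half of the Courant-Fischer principle, with \<open>i\<close> counted from
  0. \<open>S\<close> collects the eigenspaces for eigenvalues at least the chosen entry, so its
  dimension is the number of such entries with multiplicity.\<close>

lemma top_eigenspace:
  fixes f :: "'a::euclidean_space \<Rightarrow> 'a"
  assumes f: "self_adjoint f" and i: "i < DIM('a)"
  obtains S where "subspace S" "f ` S \<subseteq> S" "i < dim S"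
    "\<And>z. z \<in> S \<Longrightarrow> eigenvalue_list f ! i * (norm z)\<^sup>2 \<le> z \<bullet> f z"
proof -
  let ?E = "\<lambda>c. {x. f x = c *\<^sub>R x}"
  let ?M = "\<Sum>c\<in>eigenvalues f. replicate_mset (dim (?E c)) c"
  have lin: "linear f" using f by (simp add: self_adjoint_def)
  note fin = finite_eigenvalues[OF f]
  define c where "c = eigenvalue_list f ! i"
  define F where "F = {d \<in> eigenvalues f. c \<le> d}"
  define S where "S = span (\<Union>d\<in>F. ?E d)"
  have finF: "finite F" using fin by (simp add: F_def)
  have mset: "mset (eigenvalue_list f) = ?M" by (simp add: eigenvalue_list_def)
  \<comment> \<open>The multiplicities add up to the full dimension, so \<open>i\<close> is a valid
    position.\<close>
  have "length (eigenvalue_list f) = size ?M" by (metis mset size_mset)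
  also have "\<dots> = dim (\<Union>c\<in>eigenvalues f. ?E c)" using fin by (simp add: size_sum_mset dim_sum_eigenspaces[OF f fin])
  also have "\<dots> = DIM('a)" using span_all_eigenspaces[OF f] by (metis dim_UNIV dim_span)
  finally have len: "length (eigenvalue_list f) = DIM('a)" .
  have "sorted (rev (eigenvalue_list f))" by (simp add: eigenvalue_list_def)
  then have "Suc i \<le> length (filter (\<lambda>d. c \<le> d) (eigenvalue_list f))"
    unfolding c_def using len i by (intro length_filter_ge_sorted_desc) auto
  also have "\<dots> = size (filter_mset (\<lambda>d. c \<le> d) ?M)" by (metis mset mset_filter size_mset)
  also have "\<dots> = (\<Sum>d\<in>eigenvalues f. size (filter_mset (\<lambda>d. c \<le> d) (replicate_mset (dim (?E d)) d)))"
    using fin by (simp add: filter_sum_mset size_sum_mset)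
  also have "\<dots> = (\<Sum>d\<in>eigenvalues f. if c \<le> d then dim (?E d) else 0)"
    by (intro sum.cong refl) (simp add: size_filter_replicate_mset)
  also have "\<dots> = (\<Sum>d\<in>F. dim (?E d))"
    unfolding F_def by (intro sum.mono_neutral_cong_right fin) auto
  also have "\<dots> = dim S" by (simp add: S_def dim_sum_eigenspaces[OF f finF])
  finally have dim: "i < dim S" by simp
  have inv: "f ` S \<subseteq> S" unfolding S_def by (rule span_eigenspaces_invariant[OF lin])
  have "c * (norm z)\<^sup>2 \<le> z \<bullet> f z" if "z \<in> S" for z
  proof -
    have "S \<noteq> {0}" using dim by auto
    moreover have "(\<lambda>x. - f x) ` S \<subseteq> S" using inv by (auto simp: S_def intro: span_neg)
    \<comment> \<open>\<open>- d\<close> is the least eigenvalue of \<open>f\<close> on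
      \<open>S\<close>. Were it below \<open>c\<close>, \<open>x\<close> would be orthogonal to
      every eigenspace generating \<open>S\<close>, hence to itself.\<close>
    ultimately obtain x d where x: "x \<in> S" "x \<noteq> 0" "- f x = d *\<^sub>R x" "\<And>y. y \<in> S \<Longrightarrow> y \<bullet> - f y \<le> d * (norm y)\<^sup>2"
      using self_adjoint_top_eigenvector[OF self_adjoint_uminus[OF f], of S] S_def by (metis subspace_span)
    have fx: "f x = (- d) *\<^sub>R x" using x(3) by (metis minus_minus scaleR_minus_left)
    have "c \<le> - d"
    proof (rule ccontr)
      assume "\<not> c \<le> - d"
      then have "y \<bullet> x = 0" if "y \<in> (\<Union>d\<in>F. ?E d)" for y
        using that by (auto simp: F_def intro!: eigenspace_orthogonal[OF f _ fx])
      then have "\<forall>y\<in>S. y \<bullet> x = 0" unfolding S_def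
        using orthogonal_to_span[of _ "\<Union>d\<in>F. ?E d" x] by (auto simp: orthogonal_def inner_commute)
      with x show False by auto
    qed
    then have "c * (norm z)\<^sup>2 \<le> - d * (norm z)\<^sup>2" by (intro mult_right_mono) auto
    then show ?thesis using x(4)[OF that] by simp
  qed
  then show thesis using that[of S] inv dim by (simp add: S_def c_def)
qed

section \<open>Matrix norms, singular values and the operator T\<close>

lemma inner_transpose_vector:
  fixes X :: "real ^ 'h ^ 'n"
  shows "(transpose X *v u) \<bullet> v = u \<bullet> (X *v v)"
  by (simp add: dot_lmul_matrix)

lemma row_matrix_mult:
  fixes X :: "real ^ 'h ^ 'n" and Y :: "real ^ 'm ^ 'h"
  shows "(X ** Y) $ i = transpose Y *v (X $ i)"
  by (simp add: vec_eq_iff matrix_matrix_mult_def matrix_vector_mult_def transpose_def mult.commute)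

lemma norm_vec_power2:
  fixes X :: "real ^ 'h ^ 'n"
  shows "(norm X)\<^sup>2 = (\<Sum>i\<in>UNIV. (norm (X $ i))\<^sup>2)"
  unfolding power2_norm_eq_inner inner_vec_def by simp

lemma inner_transpose_transpose:
  fixes X Y :: "real ^ 'h ^ 'n"
  shows "transpose X \<bullet> transpose Y = X \<bullet> Y"
  unfolding inner_vec_def transpose_def by simp (rule sum.swap)

lemma norm_transpose:
  fixes X :: "real ^ 'h ^ 'n"
  shows "norm (transpose X) = norm X"
  by (simp add: norm_eq_sqrt_inner inner_transpose_transpose)

lemma inner_matrix_mult_left:
  fixes X :: "real ^ 'h ^ 'n" and Y :: "real ^ 'm ^ 'h"
  shows "(X ** Y) \<bullet> Z = X \<bullet> (Z ** transpose Y)"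
proof -
  have "(X ** Y) \<bullet> Z = (\<Sum>i\<in>UNIV. (transpose Y *v X $ i) \<bullet> (Z $ i))"
    by (subst inner_vec_def) (simp add: row_matrix_mult)
  also have "\<dots> = X \<bullet> (Z ** transpose Y)"
    by (subst (2) inner_vec_def) (simp only: row_matrix_mult inner_transpose_vector transpose_transpose)
  finally show ?thesis .
qed

lemma inner_matrix_mult_right:
  fixes X :: "real ^ 'h ^ 'n" and Y :: "real ^ 'm ^ 'h"
  shows "(X ** Y) \<bullet> Z = Y \<bullet> (transpose X ** Z)"
proof -
  have "(X ** Y) \<bullet> Z = (transpose Y ** transpose X) \<bullet> transpose Z"
    by (metis inner_transpose_transpose matrix_transpose_mul)
  also have "\<dots> = transpose Y \<bullet> transpose (transpose X ** Z)"
    by (simp add: inner_matrix_mult_left matrix_transpose_mul)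
  finally show ?thesis by (simp add: inner_transpose_transpose)
qed

lemma norm_matrix_vector_le:
  fixes X :: "real ^ 'h ^ 'n"
  shows "norm (X *v v) \<le> norm X * norm v"
proof -
  have "(X *v v) $ i = X $ i \<bullet> v" for i by (simp add: matrix_vector_mult_def inner_vec_def)
  then have "(norm (X *v v))\<^sup>2 = (\<Sum>i\<in>UNIV. (X $ i \<bullet> v)\<^sup>2)"
    unfolding power2_norm_eq_inner inner_vec_def[of "X *v v"] by (simp add: power2_eq_square)
  also have "\<dots> \<le> (\<Sum>i\<in>UNIV. (norm (X $ i))\<^sup>2 * (norm v)\<^sup>2)"
    by (intro sum_mono) (metis Cauchy_Schwarz_ineq2 abs_norm_cancel abs_mult power2_abs power_mono power_mult_distrib abs_ge_zero)
  also have "\<dots> = (norm X * norm v)\<^sup>2"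
    by (simp add: norm_vec_power2 power_mult_distrib sum_distrib_right)
  finally show ?thesis by (rule power2_le_imp_le) simp
qed

text \<open>The squared norm of \<open>transpose X *v u\<close> is the inner product of
  \<open>u\<close> with \<open>X\<close> applied to that vector; Cauchy-Schwarz and the hypothesis
  leave one factor to cancel.\<close>

lemma norm_transpose_vector_le:
  fixes X :: "real ^ 'h ^ 'n"
  assumes "\<And>v. norm (X *v v) \<le> c * norm v"
  shows "norm (transpose X *v u) \<le> c * norm u"
proof -
  let ?w = "transpose X *v u"
  have "(norm ?w)\<^sup>2 = u \<bullet> (X *v ?w)" by (simp only: power2_norm_eq_inner inner_transpose_vector)
  also have "\<dots> \<le> norm u * (c * norm ?w)"
    using norm_cauchy_schwarz assms by (meson mult_left_mono norm_ge_zero order_trans)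
  finally have *: "norm ?w * norm ?w \<le> (c * norm u) * norm ?w" by (simp add: power2_eq_square mult_ac)
  show ?thesis
  proof (cases "?w = 0")
    case True
    have "0 \<le> c" if "u \<noteq> 0" using that assms[of 1] 
      by (smt (verit) norm_ge_zero mult_neg_pos zero_neq_one zero_less_norm_iff norm_eq_zero)
    then show ?thesis using True by (cases "u = 0") auto
  qed (use * in simp)
qed

text \<open>The rows of \<open>X ** Y\<close> are \<open>transpose Y\<close> applied to the rows of
  \<open>X\<close>, so an operator bound for one factor combines with the Frobenius norm of the
  other.\<close>

lemma norm_matrix_mult_le_right:
  fixes X :: "real ^ 'h ^ 'n" and Y :: "real ^ 'm ^ 'h"
  assumes "\<And>v. norm (Y *v v) \<le> c * norm v" "0 \<le> c"
  shows "norm (X ** Y) \<le> c * norm X"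
proof (rule power2_le_imp_le)
  have "(norm (X ** Y))\<^sup>2 = (\<Sum>i\<in>UNIV. (norm (transpose Y *v X $ i))\<^sup>2)"
    unfolding norm_vec_power2 row_matrix_mult ..
  also have "\<dots> \<le> (\<Sum>i\<in>UNIV. (c * norm (X $ i))\<^sup>2)"
    by (intro sum_mono power_mono norm_transpose_vector_le assms) auto
  also have "\<dots> = (c * norm X)\<^sup>2" by (simp add: norm_vec_power2 power_mult_distrib sum_distrib_left)
  finally show "(norm (X ** Y))\<^sup>2 \<le> (c * norm X)\<^sup>2" .
qed (use assms in simp)

lemma norm_matrix_mult_le_left:
  fixes X :: "real ^ 'h ^ 'n" and Y :: "real ^ 'm ^ 'h"
  assumes "\<And>v. norm (X *v v) \<le> c * norm v" "0 \<le> c"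
  shows "norm (X ** Y) \<le> c * norm Y"
  using norm_matrix_mult_le_right[of "transpose X" c "transpose Y", OF norm_transpose_vector_le[OF assms(1)] assms(2)]
  by (simp add: norm_transpose flip: matrix_transpose_mul)

lemma norm_matrix_mult_le:
  fixes X :: "real ^ 'h ^ 'n" and Y :: "real ^ 'm ^ 'h"
  shows "norm (X ** Y) \<le> norm X * norm Y"
  by (rule norm_matrix_mult_le_left[OF norm_matrix_vector_le]) simp

lemma power2_norm_matrix_mult_ge:
  fixes X :: "real ^ 'h ^ 'n" and Y :: "real ^ 'm ^ 'h"
  assumes "\<And>v. c * (norm v)\<^sup>2 \<le> (norm (transpose Y *v v))\<^sup>2"
  shows "c * (norm X)\<^sup>2 \<le> (norm (X ** Y))\<^sup>2"
  unfolding norm_vec_power2 row_matrix_mult sum_distrib_left by (intro sum_mono assms)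

lemma power2_norm_matrix_mult_le:
  fixes X :: "real ^ 'h ^ 'n" and Y :: "real ^ 'm ^ 'h"
  assumes "\<And>v. (norm (transpose Y *v v))\<^sup>2 \<le> c * (norm v)\<^sup>2"
  shows "(norm (X ** Y))\<^sup>2 \<le> c * (norm X)\<^sup>2"
  unfolding norm_vec_power2 row_matrix_mult sum_distrib_left by (intro sum_mono assms)

section \<open>Singular values as bounds on matrix-vector products\<close>

lemma self_adjoint_matrix:
  fixes S :: "real ^ 'k ^ 'k"
  assumes "transpose S = S"
  shows "self_adjoint ((*v) S)"
  unfolding self_adjoint_def using inner_transpose_vector[of S] assms by auto

lemma inner_gram:
  fixes M :: "real ^ 'm ^ 'n"
  shows "x \<bullet> ((transpose M ** M) *v y) = (M *v x) \<bullet> (M *v y)"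
  by (metis inner_transpose_vector inner_commute matrix_vector_mul_assoc)

lemma self_adjoint_gram:
  fixes M :: "real ^ 'm ^ 'n"
  shows "self_adjoint ((*v) (transpose M ** M))"
  by (rule self_adjoint_matrix) (simp add: matrix_transpose_mul)

lemma eigenvalue_gram_nonneg:
  fixes M :: "real ^ 'm ^ 'n"
  assumes "c \<in> mat_eigenvalues (transpose M ** M)"
  shows "0 \<le> c"
proof -
  obtain x where x: "x \<noteq> 0" "(transpose M ** M) *v x = c *\<^sub>R x"
    using assms by (auto simp: mat_eigenvalues_def eigenvalues_def)
  have "c * (x \<bullet> x) = (M *v x) \<bullet> (M *v x)" using inner_gram[of x M x] x(2) by simp
  then show ?thesis using x(1) by (metis inner_ge_zero inner_gt_zero_iff zero_le_mult_iff not_le)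
qed

lemma sigma_max_nonneg: "0 \<le> sigma_max M"
  unfolding sigma_max_def
  using eigenvalue_gram_nonneg Max_eigenvalues(1)[OF self_adjoint_gram[of M]] by (auto simp: mat_eigenvalues_def)

lemma norm_le_sigma_max: "norm (M *v x) \<le> sigma_max M * norm x"
proof (rule power2_le_imp_le)
  have "0 \<le> Max (mat_eigenvalues (transpose M ** M))"
    using eigenvalue_gram_nonneg Max_eigenvalues(1)[OF self_adjoint_gram[of M]] by (auto simp: mat_eigenvalues_def)
  then show "(norm (M *v x))\<^sup>2 \<le> (sigma_max M * norm x)\<^sup>2"
    using Max_eigenvalues(2)[OF self_adjoint_gram, of x M]
    by (simp add: inner_gram power2_norm_eq_inner sigma_max_def power_mult_distrib mat_eigenvalues_def)
qed (simp add: sigma_max_nonneg)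

lemma Min_gram_nonneg: "0 \<le> Min (mat_eigenvalues (transpose M ** M))"
  using eigenvalue_gram_nonneg Min_eigenvalues(1)[OF self_adjoint_gram[of M]] by (auto simp: mat_eigenvalues_def)

lemma sigma_min_transpose: "sigma_min (transpose M) = sigma_min M"
  by (simp add: sigma_min_def min.commute)

text \<open>Holds also when \<open>M\<close> is wide and has a kernel, because
  \<open>sigma_min\<close> takes the smaller of the two Gram spectra and is then 0.\<close>

lemma sigma_min_le_norm: "sigma_min M * norm x \<le> norm (M *v x)"
proof (rule power2_le_imp_le)
  have "(sigma_min M)\<^sup>2 \<le> Min (mat_eigenvalues (transpose M ** M))"
    unfolding sigma_min_def using Min_gram_nonneg[of M] Min_gram_nonneg[of "transpose M"] by simp
  then have "(sigma_min M)\<^sup>2 * (norm x)\<^sup>2 \<le> Min (mat_eigenvalues (transpose M ** M)) * (norm x)\<^sup>2"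
    by (rule mult_right_mono) simp
  also have "\<dots> \<le> (norm (M *v x))\<^sup>2"
    using Min_eigenvalues(2)[OF self_adjoint_gram, of M x]
    by (simp add: inner_gram power2_norm_eq_inner mat_eigenvalues_def)
  finally show "(sigma_min M * norm x)\<^sup>2 \<le> (norm (M *v x))\<^sup>2" by (simp add: power_mult_distrib)
qed simp

lemma le_lambda_max:
  fixes S :: "real ^ 'k ^ 'k"
  assumes "transpose S = S"
  shows "v \<bullet> (S *v v) \<le> lambda_max S * (norm v)\<^sup>2"
  using Max_eigenvalues(2)[OF self_adjoint_matrix[OF assms]] by (simp add: lambda_max_def mat_eigenvalues_def)

section \<open>The operator T and its extremal eigenvalues\<close>

lemma linear_T_op: "linear (T_op A B)"
proof (rule linearI)
  fix x y :: "real ^ 'a ^ 'b" and c :: real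
  have t: "transpose (x + y) = transpose x + transpose y" "transpose (c *\<^sub>R x) = c *\<^sub>R transpose x"
    by (simp_all add: transpose_def vec_eq_iff)
  show "T_op A B (x + y) = T_op A B x + T_op A B y"
    unfolding T_op_def t
    by (simp add: vec_eq_iff matrix_matrix_mult_def distrib_right sum.distrib split: sum.split)
  show "T_op A B (c *\<^sub>R x) = c *\<^sub>R T_op A B x"
    unfolding T_op_def t
    by (simp add: vec_eq_iff matrix_matrix_mult_def sum_distrib_left mult.assoc split: sum.split)
qed

lemma inner_T_op: "T_op A B U \<bullet> T_op A B V = (U ** B) \<bullet> (V ** B) + (transpose U ** A) \<bullet> (transpose V ** A)"
  unfolding inner_vec_def[of "T_op A B U"]
  by (subst UNIV_Plus_UNIV[symmetric], subst sum.Plus)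
     (simp_all add: T_op_def inner_vec_def[of "U ** B"] inner_vec_def[of "transpose U ** A"])

lemma self_adjoint_T_op: "self_adjoint (adjoint (T_op A B) \<circ> T_op A B)"
  unfolding self_adjoint_def
  by (auto simp: linear_T_op adjoint_works[OF linear_T_op] adjoint_linear inner_commute
      intro!: linear_compose)

lemma inner_T_op_adjoint: "U \<bullet> (adjoint (T_op A B) \<circ> T_op A B) U = (norm (T_op A B U))\<^sup>2"
  by (simp add: adjoint_works[OF linear_T_op] power2_norm_eq_inner)

lemma power2_norm_T_op: "(norm (T_op A B U))\<^sup>2 = (norm (U ** B))\<^sup>2 + (norm (transpose U ** A))\<^sup>2"
  by (simp add: power2_norm_eq_inner inner_T_op)

lemma sigma_sq_T_bounds:
  "sigma_min_sq_T A B * (norm U)\<^sup>2 \<le> (norm (T_op A B U))\<^sup>2"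
  "(norm (T_op A B U))\<^sup>2 \<le> sigma_max_sq_T A B * (norm U)\<^sup>2"
  using Min_eigenvalues(2)[OF self_adjoint_T_op, of A B U] Max_eigenvalues(2)[OF self_adjoint_T_op, of U A B]
  unfolding sigma_min_sq_T_def sigma_max_sq_T_def inner_T_op_adjoint .

text \<open>Evaluation at these matrices turns estimates of \<open>norm (T_op A B U)\<close> into
  estimates of the extremal eigenvalues.\<close>

lemma sigma_sq_T_attained:
  obtains U V where "U \<noteq> 0" "(norm (T_op A B U))\<^sup>2 = sigma_min_sq_T A B * (norm U)\<^sup>2"
    "V \<noteq> 0" "(norm (T_op A B V))\<^sup>2 = sigma_max_sq_T A B * (norm V)\<^sup>2"
proof -
  let ?f = "adjoint (T_op A B) \<circ> T_op A B"
  obtain U where "U \<noteq> 0" "?f U = sigma_min_sq_T A B *\<^sub>R U"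
    using Min_eigenvalues(1)[OF self_adjoint_T_op, of A B] 
    by (auto simp: eigenvalues_def sigma_min_sq_T_def)
  moreover obtain V where "V \<noteq> 0" "?f V = sigma_max_sq_T A B *\<^sub>R V"
    using Max_eigenvalues(1)[OF self_adjoint_T_op, of A B] 
    by (auto simp: eigenvalues_def sigma_max_sq_T_def)
  ultimately show thesis
    using inner_T_op_adjoint[of U A B] inner_T_op_adjoint[of V A B] that[of U V]
    by (simp add: power2_norm_eq_inner del: comp_apply)
qed

lemma sigma_min_sq_T_ge:
  assumes "\<And>u. p * (norm u)\<^sup>2 \<le> (norm (transpose A *v u))\<^sup>2"
    and "\<And>w. q * (norm w)\<^sup>2 \<le> (norm (transpose B *v w))\<^sup>2"
  shows "p + q \<le> sigma_min_sq_T A B"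
proof -
  obtain U where U: "U \<noteq> 0" "(norm (T_op A B U))\<^sup>2 = sigma_min_sq_T A B * (norm U)\<^sup>2"
    by (rule sigma_sq_T_attained)
  have "p * (norm U)\<^sup>2 \<le> (norm (transpose U ** A))\<^sup>2"
    using power2_norm_matrix_mult_ge[OF assms(1), of "transpose U"] by (simp add: norm_transpose)
  moreover have "q * (norm U)\<^sup>2 \<le> (norm (U ** B))\<^sup>2"
    by (rule power2_norm_matrix_mult_ge[OF assms(2)])
  ultimately have "(p + q) * (norm U)\<^sup>2 \<le> sigma_min_sq_T A B * (norm U)\<^sup>2"
    unfolding U(2)[symmetric] power2_norm_T_op by (simp add: algebra_simps)
  then show ?thesis using U(1) by simp
qed

lemma sigma_max_sq_T_le:
  assumes "\<And>u. (norm (transpose A *v u))\<^sup>2 \<le> p * (norm u)\<^sup>2"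
    and "\<And>w. (norm (transpose B *v w))\<^sup>2 \<le> q * (norm w)\<^sup>2"
  shows "sigma_max_sq_T A B \<le> p + q"
proof -
  obtain U where U: "U \<noteq> 0" "(norm (T_op A B U))\<^sup>2 = sigma_max_sq_T A B * (norm U)\<^sup>2"
    by (rule sigma_sq_T_attained)
  have "(norm (transpose U ** A))\<^sup>2 \<le> p * (norm U)\<^sup>2"
    using power2_norm_matrix_mult_le[OF assms(1), of "transpose U"] by (simp add: norm_transpose)
  moreover have "(norm (U ** B))\<^sup>2 \<le> q * (norm U)\<^sup>2"
    by (rule power2_norm_matrix_mult_le[OF assms(2)])
  ultimately have "sigma_max_sq_T A B * (norm U)\<^sup>2 \<le> (p + q) * (norm U)\<^sup>2"
    unfolding U(2)[symmetric] power2_norm_T_op by (simp add: algebra_simps)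
  then show ?thesis using U(1) by simp
qed

lemma sigma_min_sq_T_nonneg: "0 \<le> sigma_min_sq_T A B"
  using sigma_min_sq_T_ge[of 0 A 0 B] by simp

lemma sigma_min_sq_T_le_max: "sigma_min_sq_T A B \<le> sigma_max_sq_T A B"
proof -
  obtain U where U: "U \<noteq> 0" "(norm (T_op A B U))\<^sup>2 = sigma_min_sq_T A B * (norm U)\<^sup>2"
    by (rule sigma_sq_T_attained)
  then have "sigma_min_sq_T A B * (norm U)\<^sup>2 \<le> sigma_max_sq_T A B * (norm U)\<^sup>2"
    using sigma_sq_T_bounds(2) by metis
  then show ?thesis using U(1) by simp
qed

lemma norm_outer_mult:
  fixes Y :: "real ^ 'h ^ 'm" and u :: "real ^ 'n" and w :: "real ^ 'm"
  shows "norm ((\<chi> i j. u $ i * w $ j) ** Y) = norm u * norm (transpose Y *v w)"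
proof -
  have "((\<chi> i j. u $ i * w $ j) ** Y) $ i = u $ i *\<^sub>R (transpose Y *v w)" for i
    by (simp add: row_matrix_mult vec_eq_iff matrix_vector_mult_def sum_distrib_left mult_ac)
  then have "(norm ((\<chi> i j. u $ i * w $ j) ** Y))\<^sup>2 = (\<Sum>i\<in>UNIV. (u $ i)\<^sup>2 * (norm (transpose Y *v w))\<^sup>2)"
    by (simp add: norm_vec_power2 power_mult_distrib)
  also have "\<dots> = (norm u * norm (transpose Y *v w))\<^sup>2"
    by (simp add: power_mult_distrib sum_distrib_right norm_vec_def[of u] L2_set_def sum_nonneg)
  finally show ?thesis by (rule power2_eq_imp_eq) auto
qed

lemma norm_outer:
  fixes u :: "real ^ 'n" and w :: "real ^ 'm"
  shows "norm (\<chi> i j. u $ i * w $ j) = norm u * norm w"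
  using norm_outer_mult[of u w "mat 1"] by simp

text \<open>On a rank-one matrix \<open>x y^T\<close> the squared norm of \<open>T_op\<close>
  separates into one term per factor. Each claim fixes the other vector at norm 1 and discards the
  other nonnegative term.\<close>

lemma power2_norm_le_sigma_max_sq_T:
  fixes A :: "real ^ 'h ^ 'n" and B :: "real ^ 'h ^ 'm"
  shows "(norm (transpose A *v u))\<^sup>2 \<le> sigma_max_sq_T A B * (norm u)\<^sup>2"
    and "(norm (transpose B *v w))\<^sup>2 \<le> sigma_max_sq_T A B * (norm w)\<^sup>2"
proof -
  have key: "(norm x)\<^sup>2 * (norm (transpose B *v y))\<^sup>2 + (norm y)\<^sup>2 * (norm (transpose A *v x))\<^sup>2
      \<le> sigma_max_sq_T A B * ((norm x)\<^sup>2 * (norm y)\<^sup>2)" for x y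
  proof -
    have "transpose (\<chi> i j. x $ i * y $ j) = (\<chi> i j. y $ i * x $ j)" by (simp add: transpose_def vec_eq_iff)
    then show ?thesis
      using sigma_sq_T_bounds(2)[of A B "\<chi> i j. x $ i * y $ j"]
      by (simp add: power2_norm_T_op norm_outer_mult norm_outer power_mult_distrib)
  qed
  obtain x :: "real ^ 'n" where x: "norm x = 1" using vector_choose_size[OF zero_le_one] .
  obtain y :: "real ^ 'm" where y: "norm y = 1" using vector_choose_size[OF zero_le_one] .
  have "0 \<le> (norm u)\<^sup>2 * (norm (transpose B *v y))\<^sup>2" "0 \<le> (norm w)\<^sup>2 * (norm (transpose A *v x))\<^sup>2"
    by simp_all
  then show "(norm (transpose A *v u))\<^sup>2 \<le> sigma_max_sq_T A B * (norm u)\<^sup>2"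
    and "(norm (transpose B *v w))\<^sup>2 \<le> sigma_max_sq_T A B * (norm w)\<^sup>2"
    using key[of u y] key[of x w] by (simp_all only: x y mult_1 mult_1_right one_power2)
qed

section \<open>Singular values of T and the imbalance\<close>

text \<open>Splitting \<open>w\<close> along \<open>S\<close> and its complement splits the form,
  since \<open>S\<close> is invariant, and \<open>z\<close> sees only the part in \<open>S\<close>.
  In effect \<open>f + c\<close> dominates \<open>a + c\<close> times the projection onto
  \<open>S\<close>; phrased through one inner product, this tolerates a later perturbation of the
  form.\<close>

lemma invariant_subspace_form_ge:
  fixes f :: "'a::euclidean_space \<Rightarrow> 'a"
  assumes f: "self_adjoint f" and S: "subspace S" "f ` S \<subseteq> S"
    and a: "\<And>s. s \<in> S \<Longrightarrow> a * (norm s)\<^sup>2 \<le> s \<bullet> f s"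
    and c: "\<And>w. - c * (norm w)\<^sup>2 \<le> w \<bullet> f w" and "0 \<le> a + c" and z: "z \<in> S"
  shows "(a + c) * (z \<bullet> w)\<^sup>2 \<le> (norm z)\<^sup>2 * (w \<bullet> f w + c * (norm w)\<^sup>2)"
proof -
  have lin: "linear f" and sa: "\<And>x y. f x \<bullet> y = x \<bullet> f y" using f by (auto simp: self_adjoint_def)
  obtain s q where sq: "s \<in> span S" "\<And>v. v \<in> span S \<Longrightarrow> orthogonal q v" "w = s + q"
    using orthogonal_subspace_decomp_exists[of S w] by metis
  have span: "span S = S" using S(1) by (simp add: span_eq_iff)
  have s: "s \<in> S" and q: "\<And>v. v \<in> S \<Longrightarrow> v \<bullet> q = 0"
    using sq(1,2) unfolding span by (auto simp: orthogonal_def inner_commute)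
  have "f s \<bullet> q = 0" using q S(2) s by blast
  moreover from this have "s \<bullet> f q = 0" by (simp add: sa)
  ultimately have form: "w \<bullet> f w = s \<bullet> f s + q \<bullet> f q"
    by (simp add: sq(3) linear_add[OF lin] inner_simps inner_commute)
  have norm: "(norm w)\<^sup>2 = (norm s)\<^sup>2 + (norm q)\<^sup>2"
    using q[OF s] by (simp add: sq(3) power2_norm_eq_inner inner_simps inner_commute)
  have "z \<bullet> w = z \<bullet> s" using q[OF z] by (simp add: sq(3) inner_simps)
  then have "(a + c) * (z \<bullet> w)\<^sup>2 \<le> (a + c) * ((norm z)\<^sup>2 * (norm s)\<^sup>2)"
    using Cauchy_Schwarz_ineq[of z s] \<open>0 \<le> a + c\<close> by (simp add: power2_norm_eq_inner mult_left_mono)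
  also have "\<dots> = (norm z)\<^sup>2 * ((a + c) * (norm s)\<^sup>2)" by (simp add: mult_ac)
  also have "\<dots> \<le> (norm z)\<^sup>2 * (w \<bullet> f w + c * (norm w)\<^sup>2)"
    using a[OF s] c[of q] unfolding form norm by (intro mult_left_mono) (auto simp: algebra_simps)
  finally show ?thesis .
qed

lemma gram_eigenvector_norms:
  fixes X :: "real ^ 'h ^ 'n"
  assumes "norm u = 1" "X *v (transpose X *v u) = p *\<^sub>R u"
  shows "(norm (transpose X *v u))\<^sup>2 = p" "(norm (X *v (transpose X *v u)))\<^sup>2 = p\<^sup>2"
proof -
  have "(norm (transpose X *v u))\<^sup>2 = u \<bullet> (X *v (transpose X *v u))"
    by (simp only: power2_norm_eq_inner inner_transpose_vector)
  also have "\<dots> = p" using assms by (simp only: inner_scaleR_right flip: power2_norm_eq_inner) simp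
  finally show "(norm (transpose X *v u))\<^sup>2 = p" .
  show "(norm (X *v (transpose X *v u)))\<^sup>2 = p\<^sup>2" using assms by (simp only: norm_scaleR) simp
qed

text \<open>The vector \<open>z\<close> of \<open>S\<close> with \<open>X z = (p + c) u\<close> is chosen because then \<open>w = z - X\<^sup>T u\<close> satisfies
  \<open>(X\<^sup>T X + c) w = c z\<close>: testing the form inequality on \<open>w\<close> bounds the norm of \<open>z\<close>, and testing it on
  \<open>X\<^sup>T u\<close> then gives the claim.\<close>

lemma gram_eigenvector_bounds:
  fixes X :: "real ^ 'h ^ 'n" and Y :: "real ^ 'h ^ 'm"
  assumes u: "norm u = 1" "X *v (transpose X *v u) = p *\<^sub>R u"
    and S: "subspace S" "CARD('n) \<le> dim S" and a: "0 < a" and c: "0 \<le> c"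
    and form: "\<And>z w. z \<in> S \<Longrightarrow>
      (a + c) * (z \<bullet> w)\<^sup>2 \<le> (norm z)\<^sup>2 * ((norm (X *v w))\<^sup>2 - (norm (Y *v w))\<^sup>2 + c * (norm w)\<^sup>2)"
  shows "a \<le> p" "(norm (Y *v (transpose X *v u)))\<^sup>2 \<le> (p - a) * (p + c)"
proof -
  define y where "y = transpose X *v u"
  have y: "(norm y)\<^sup>2 = p" "(norm (X *v y))\<^sup>2 = p\<^sup>2" "X *v y = p *\<^sub>R u"
    using gram_eigenvector_norms[OF u] u(2) by (simp_all only: y_def)
  have uX: "u \<bullet> (X *v v) = y \<bullet> v" for v by (simp only: y_def inner_transpose_vector)
  \<comment> \<open>The case \<open>w = z\<close> of \<open>form\<close>, where the term of
    \<open>Y\<close> has the favourable sign.\<close>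
  have Xge: "a * (norm z)\<^sup>2 \<le> (norm (X *v z))\<^sup>2" if "z \<in> S" for z
  proof (cases "z = 0")
    case False
    have "(norm z)\<^sup>2 * ((a + c) * (norm z)\<^sup>2) \<le> (norm z)\<^sup>2 * ((norm (X *v z))\<^sup>2 - (norm (Y *v z))\<^sup>2 + c * (norm z)\<^sup>2)"
      using form[OF that, of z] unfolding power2_norm_eq_inner[symmetric] power2_eq_square by (simp add: mult_ac)
    then have "(a + c) * (norm z)\<^sup>2 \<le> (norm (X *v z))\<^sup>2 - (norm (Y *v z))\<^sup>2 + c * (norm z)\<^sup>2"
      using False by (subst (asm) mult_le_cancel_left_pos) auto
    moreover have "0 \<le> (norm (Y *v z))\<^sup>2" by simp
    ultimately show ?thesis unfolding distrib_right by linarith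
  qed simp
  \<comment> \<open>Injectivity on \<open>S\<close>, whose dimension is at least that of the
    codomain, makes \<open>X\<close> map \<open>S\<close> onto the whole space; this supplies the
    preimages below.\<close>
  have inj: "inj_on ((*v) X) S"
  proof (rule inj_onI)
    fix v w assume vw: "v \<in> S" "w \<in> S" "X *v v = X *v w"
    have "a * (norm (v - w))\<^sup>2 \<le> (norm (X *v (v - w)))\<^sup>2"
      using vw S(1) by (intro Xge) (simp add: subspace_diff)
    then show "v = w" using vw(3) a by (simp add: matrix_vector_mult_diff_distrib mult_le_0_iff)
  qed
  have span: "span S = S" using S(1) by (simp add: span_eq_iff)
  have "dim ((*v) X ` S) = dim S"
    using dim_image_eq[OF matrix_vector_mul_linear, of X S] inj by (simp add: span)
  with S(2) have "DIM(real ^ 'n) \<le> dim ((*v) X ` S)" by simp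
  then have "span ((*v) X ` S) = UNIV"
    by (metis dim_eq_full dim_subset_UNIV le_antisym)
  then have "(*v) X ` S = UNIV"
    using span_linear_image[OF matrix_vector_mul_linear, of X S] by (simp add: span)
  then have surj: "\<exists>z\<in>S. X *v z = v" for v
    by (metis (no_types) UNIV_I imageE)
  show ap: "a \<le> p"
  proof -
    \<comment> \<open>Cauchy-Schwarz gives \<open>1 <= p |z|^2\<close> for this preimage, while
      \<open>Xge\<close> gives \<open>a |z|^2 <= 1\<close>.\<close>
    obtain z where z: "z \<in> S" "X *v z = u" using surj by blast
    have "1 = y \<bullet> z" using uX[of z] z(2) u(1) by (simp add: norm_eq_1)
    then have "1 \<le> p * (norm z)\<^sup>2" using Cauchy_Schwarz_ineq[of y z] y(1) by (simp add: power2_norm_eq_inner)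
    moreover have "a * (norm z)\<^sup>2 \<le> 1" using Xge[OF z(1)] z(2) u(1) by simp
    ultimately have "a * (norm z)\<^sup>2 \<le> p * (norm z)\<^sup>2" by linarith
    moreover have "z \<noteq> 0" using \<open>1 = y \<bullet> z\<close> by auto
    ultimately show ?thesis by simp
  qed
  obtain z where z: "z \<in> S" "X *v z = (p + c) *\<^sub>R u" using surj by blast
  define N where "N = (norm z)\<^sup>2"
  have zy: "z \<bullet> y = p + c" using uX[of z] z(2) u(1) by (simp add: norm_eq_1 inner_commute)
  then have "z \<noteq> 0" using ap a c by auto
  then have N: "N > 0" by (simp add: N_def)
  define s where "s = N - (p + c)"
  have zw: "z \<bullet> (z - y) = s" by (simp add: inner_simps zy s_def N_def power2_norm_eq_inner)
  have "X *v (z - y) = c *\<^sub>R u" by (simp add: matrix_vector_mult_diff_distrib z(2) y(3) flip: scaleR_left_diff_distrib)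
  then have Xw: "(norm (X *v (z - y)))\<^sup>2 = c\<^sup>2" using u(1) by simp
  have nw: "(norm (z - y))\<^sup>2 = N - 2 * (p + c) + p"
    using zy y(1) by (simp add: power2_norm_eq_inner N_def inner_simps inner_commute)
  have "(a + c) * s\<^sup>2 \<le> N * (c\<^sup>2 - (norm (Y *v (z - y)))\<^sup>2 + c * (N - 2 * (p + c) + p))"
    using form[OF z(1), of "z - y"] unfolding zw Xw nw N_def[symmetric] .
  also have "\<dots> \<le> N * (c\<^sup>2 + c * (N - 2 * (p + c) + p))" using N by (intro mult_left_mono) auto
  also have "\<dots> = N * c * s" by (simp add: s_def algebra_simps power2_eq_square)
  finally have s2: "(a + c) * s\<^sup>2 \<le> N * c * s" .
  \<comment> \<open>An upper bound on \<open>N\<close> from \<open>s2\<close>: a positive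
    \<open>s\<close> can be cancelled, and otherwise \<open>N <= p + c\<close> already.\<close>
  have aN: "a * N \<le> (a + c) * (p + c)"
  proof (cases "s > 0")
    case True
    have "s * ((a + c) * s) \<le> s * (N * c)" using s2 by (simp add: power2_eq_square mult_ac)
    then have "(a + c) * s \<le> N * c" using True by simp
    then show ?thesis by (simp add: s_def algebra_simps)
  next
    case False
    then have "a * N \<le> a * (p + c)" using a by (simp add: s_def)
    also have "\<dots> \<le> (a + c) * (p + c)" using c ap a by (intro mult_right_mono) auto
    finally show ?thesis .
  qed
  have "a * N * (p + c) \<le> (a + c) * (p + c) * (p + c)" using aN ap a c by (intro mult_right_mono) auto
  also have "\<dots> = (a + c) * (z \<bullet> y)\<^sup>2" by (simp add: zy power2_eq_square mult_ac)
  also have "\<dots> \<le> N * (p\<^sup>2 - (norm (Y *v y))\<^sup>2 + c * p)"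
    using form[OF z(1), of y] unfolding y(1,2) N_def[symmetric] .
  finally have "N * (a * (p + c)) \<le> N * (p\<^sup>2 - (norm (Y *v y))\<^sup>2 + c * p)" by (simp add: mult_ac)
  then have "a * (p + c) \<le> p\<^sup>2 - (norm (Y *v y))\<^sup>2 + c * p" using N by simp
  then show "(norm (Y *v (transpose X *v u)))\<^sup>2 \<le> (p - a) * (p + c)"
    unfolding y_def[symmetric] by (simp add: algebra_simps power2_eq_square)
qed

text \<open>The Gram lemmas concern \<open>transpose M ** M\<close>; the double transpose is the
  instance \<open>M = transpose X\<close>, that is, \<open>X X^T\<close>.\<close>

lemma unit_gram_eigenvector:
  fixes X :: "real ^ 'h ^ 'n"
  assumes "p \<in> eigenvalues ((*v) (transpose (transpose X) ** transpose X))"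
  obtains u where "norm u = 1" "X *v (transpose X *v u) = p *\<^sub>R u"
proof -
  obtain v where v: "v \<noteq> 0" "(X ** transpose X) *v v = p *\<^sub>R v"
    using assms by (auto simp: eigenvalues_def)
  show thesis
  proof (rule that[of "(1 / norm v) *\<^sub>R v"])
    have "X *v (transpose X *v v) = p *\<^sub>R v" using v(2) by (metis matrix_vector_mul_assoc)
    then show "X *v (transpose X *v ((1 / norm v) *\<^sub>R v)) = p *\<^sub>R ((1 / norm v) *\<^sub>R v)"
      by (simp only: matrix_vector_mult_scaleR scaleR_left_commute)
  qed (use v in simp)
qed

text \<open>Let \<open>u\<close> be a unit eigenvector for the least eigenvalue \<open>p\<close> of
  \<open>X X^T\<close>. As \<open>Y X^T u\<close> has norm at least \<open>b\<close>,
  \<open>p\<close> satisfies a quadratic inequality; for \<open>e < a\<close> the claimed bound is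
  its larger root. \<open>g\<close> is the unperturbed form and \<open>e\<close> the size of the
  perturbation.\<close>

lemma gram_lower_bound:
  fixes X :: "real ^ 'h ^ 'n" and Y :: "real ^ 'h ^ 'm" and g :: "real ^ 'h \<Rightarrow> real"
  assumes "0 \<le> a" "0 \<le> c" "0 \<le> e" "0 \<le> b"
    and S: "0 < a \<Longrightarrow> \<exists>S. subspace S \<and> CARD('n) \<le> dim S \<and>
        (\<forall>z\<in>S. \<forall>w. (a + c) * (z \<bullet> w)\<^sup>2 \<le> (norm z)\<^sup>2 * (g w + c * (norm w)\<^sup>2))"
    and g: "\<And>w. - c * (norm w)\<^sup>2 \<le> g w"
    and pert: "\<And>w. g w - e * (norm w)\<^sup>2 \<le> (norm (X *v w))\<^sup>2 - (norm (Y *v w))\<^sup>2"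
    and b: "\<And>u. b * norm u \<le> norm (Y *v (transpose X *v u))"
  shows "((a - c + sqrt ((a + c)\<^sup>2 + 4 * b\<^sup>2)) / 2 - e) * (norm v)\<^sup>2 \<le> (norm (transpose X *v v))\<^sup>2"
proof -
  define p where "p = Min (eigenvalues ((*v) (transpose (transpose X) ** transpose X)))"
  have pv: "p * (norm v)\<^sup>2 \<le> (norm (transpose X *v v))\<^sup>2"
    using Min_eigenvalues(2)[OF self_adjoint_gram[of "transpose X"], of v]
    unfolding inner_gram p_def power2_norm_eq_inner[of "transpose X *v v"] .
  obtain u where u: "norm u = 1" "X *v (transpose X *v u) = p *\<^sub>R u"
    using unit_gram_eigenvector[OF Min_eigenvalues(1)[OF self_adjoint_gram[of "transpose X"]]]
    unfolding p_def by metis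
  define y where "y = transpose X *v u"
  have y: "(norm y)\<^sup>2 = p" "(norm (X *v y))\<^sup>2 = p\<^sup>2"
    using gram_eigenvector_norms[OF u] by (simp_all only: y_def)
  have "p \<ge> 0" using y(1) by (metis zero_le_power2)
  have bY: "b\<^sup>2 \<le> (norm (Y *v y))\<^sup>2"
    using b[of u] u(1) \<open>0 \<le> b\<close> unfolding y_def by (intro power_mono) auto
  have "(a - c + sqrt ((a + c)\<^sup>2 + 4 * b\<^sup>2)) / 2 - e \<le> p"
  proof (cases "e < a")
    case True
    then obtain S where S: "subspace S" "CARD('n) \<le> dim S"
      "\<And>z w. z \<in> S \<Longrightarrow> (a + c) * (z \<bullet> w)\<^sup>2 \<le> (norm z)\<^sup>2 * (g w + c * (norm w)\<^sup>2)"
      using S \<open>0 \<le> e\<close> by auto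
    \<comment> \<open>Perturbation replaces \<open>a\<close> by \<open>a - e\<close> and
      \<open>c\<close> by \<open>c + e\<close>. The sum is unchanged, so the subspace of the
      unperturbed form still serves and the root moves by exactly \<open>- e\<close>.\<close>
    have *: "((a - e) + (c + e)) * (z \<bullet> w)\<^sup>2
        \<le> (norm z)\<^sup>2 * ((norm (X *v w))\<^sup>2 - (norm (Y *v w))\<^sup>2 + (c + e) * (norm w)\<^sup>2)" if "z \<in> S" for z w
    proof -
      have "(norm z)\<^sup>2 * (g w + c * (norm w)\<^sup>2)
          \<le> (norm z)\<^sup>2 * ((norm (X *v w))\<^sup>2 - (norm (Y *v w))\<^sup>2 + (c + e) * (norm w)\<^sup>2)"
        using pert[of w] by (intro mult_left_mono) (auto simp: algebra_simps)
      with S(3)[OF that, of w] show ?thesis by simp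
    qed
    have "0 < a - e" "0 \<le> c + e" using True assms(2,3) by auto
    from gram_eigenvector_bounds[OF u S(1,2) this *]
    have p: "a - e \<le> p" "b\<^sup>2 \<le> (p - (a - e)) * (p + (c + e))"
      using bY by (simp_all add: y_def)
    \<comment> \<open>The right side minus \<open>(a + c)^2\<close> is
      \<open>4 (p - a + e) (p + c + e)\<close>.\<close>
    have "(a + c)\<^sup>2 + 4 * b\<^sup>2 \<le> (2 * p - a + c + 2 * e)\<^sup>2"
      using p(2) by (simp add: power2_eq_square algebra_simps)
    moreover have "0 \<le> 2 * p - a + c + 2 * e" using p(1) \<open>0 \<le> p\<close> assms(2,3) by linarith
    ultimately have "sqrt ((a + c)\<^sup>2 + 4 * b\<^sup>2) \<le> 2 * p - a + c + 2 * e"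
      by (intro real_le_lsqrt)
    then show ?thesis by (simp add: divide_simps)
  next
    case False
    \<comment> \<open>For \<open>a <= e\<close> the global lower bound on the form suffices, since
      \<open>a + c\<close> may be replaced by the larger \<open>c + e\<close>.\<close>
    have "(norm (Y *v y))\<^sup>2 \<le> p\<^sup>2 + (c + e) * p"
      using pert[of y] g[of y] unfolding y by (simp add: algebra_simps)
    with bY have b2: "b\<^sup>2 \<le> p\<^sup>2 + (c + e) * p" by linarith
    have "(a + c)\<^sup>2 \<le> (c + e)\<^sup>2" using False assms by (intro power_mono) auto
    then have "(a + c)\<^sup>2 + 4 * b\<^sup>2 \<le> (2 * p + c + e)\<^sup>2"
      using b2 by (simp add: power2_eq_square algebra_simps)
    moreover have "0 \<le> 2 * p + c + e" using \<open>0 \<le> p\<close> assms(2,3) by linarith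
    ultimately have "sqrt ((a + c)\<^sup>2 + 4 * b\<^sup>2) \<le> 2 * p + c + e"
      by (intro real_le_lsqrt)
    then show ?thesis using False by (simp add: divide_simps)
  qed
  then show ?thesis by (rule order_trans[OF mult_right_mono[OF _ zero_le_power2] pv])
qed

text \<open>Same argument at the greatest eigenvalue, which satisfies
  \<open>p^2 - (c + e) p <= b^2\<close>.\<close>

lemma gram_upper_bound:
  fixes X :: "real ^ 'h ^ 'n" and Y :: "real ^ 'h ^ 'm"
  assumes "0 \<le> c" "0 \<le> e"
    and pert: "\<And>w. (norm (X *v w))\<^sup>2 - (norm (Y *v w))\<^sup>2 \<le> (c + e) * (norm w)\<^sup>2"
    and b: "\<And>u. norm (Y *v (transpose X *v u)) \<le> b * norm u"
  shows "(norm (transpose X *v v))\<^sup>2 \<le> ((c + sqrt (c\<^sup>2 + 4 * b\<^sup>2)) / 2 + e) * (norm v)\<^sup>2"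
proof -
  define p where "p = Max (eigenvalues ((*v) (transpose (transpose X) ** transpose X)))"
  have pv: "(norm (transpose X *v v))\<^sup>2 \<le> p * (norm v)\<^sup>2"
    using Max_eigenvalues(2)[OF self_adjoint_gram[of "transpose X"], of v]
    unfolding inner_gram p_def power2_norm_eq_inner[of "transpose X *v v"] .
  obtain u where u: "norm u = 1" "X *v (transpose X *v u) = p *\<^sub>R u"
    using unit_gram_eigenvector[OF Max_eigenvalues(1)[OF self_adjoint_gram[of "transpose X"]]]
    unfolding p_def by metis
  define y where "y = transpose X *v u"
  have y: "(norm y)\<^sup>2 = p" "(norm (X *v y))\<^sup>2 = p\<^sup>2"
    using gram_eigenvector_norms[OF u] by (simp_all only: y_def)
  have "(norm (Y *v y))\<^sup>2 \<le> b\<^sup>2"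
    using b[of u] u(1) unfolding y_def by (intro power_mono) auto
  moreover have "p\<^sup>2 - (norm (Y *v y))\<^sup>2 \<le> (c + e) * p" using pert[of y] unfolding y .
  ultimately have b2: "p\<^sup>2 - (c + e) * p \<le> b\<^sup>2" by linarith
  define r where "r = sqrt (c\<^sup>2 + 4 * b\<^sup>2)"
  have r: "r\<^sup>2 = c\<^sup>2 + 4 * b\<^sup>2" "0 \<le> r" by (simp_all add: r_def)
  \<comment> \<open>Ensures \<open>(c + e)^2 + 4 b^2 <= (r + e)^2\<close>, so passing from
    \<open>c\<close> to \<open>c + e\<close> raises the root by at most \<open>e\<close>.\<close>
  have "c \<le> r" unfolding r_def by (rule real_le_rsqrt) simp
  then have "e * c \<le> e * r" using \<open>0 \<le> e\<close> by (rule mult_left_mono)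
  then have "(2 * p - (c + e))\<^sup>2 \<le> (r + e)\<^sup>2"
    using b2 r(1) by (simp add: power2_eq_square algebra_simps)
  then have "2 * p - (c + e) \<le> r + e" by (rule power2_le_imp_le) (use r(2) \<open>0 \<le> e\<close> in simp)
  then have "p \<le> (c + r) / 2 + e" by (simp add: divide_simps)
  then show ?thesis unfolding r_def by (rule order_trans[OF pv mult_right_mono[OF _ zero_le_power2]])
qed

section \<open>The imbalance form and the bounds expressed by its eigenvalues\<close>

lemma inner_imbalance:
  "w \<bullet> (imbalance A B *v w) = (norm (A *v w))\<^sup>2 - (norm (B *v w))\<^sup>2"
  by (simp only: imbalance_def matrix_vector_mult_diff_rdistrib inner_diff_right inner_gram power2_norm_eq_inner)

lemma transpose_diff:
  fixes X Y :: "real ^ 'm ^ 'n"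
  shows "transpose (X - Y) = transpose X - transpose Y"
  by (simp add: transpose_def vec_eq_iff)

lemma transpose_imbalance: "transpose (imbalance A B) = imbalance A B"
  by (simp add: imbalance_def matrix_transpose_mul transpose_diff)

lemma uminus_imbalance: "- imbalance A B = imbalance B A"
  by (simp add: imbalance_def)

lemma lambda_plus_swap: "lambda_plus B A = lambda_minus A B"
  by (simp add: lambda_plus_def lambda_minus_def uminus_imbalance)

lemma imbalance_le_lambda_plus:
  "(norm (A *v w))\<^sup>2 - (norm (B *v w))\<^sup>2 \<le> lambda_plus A B * (norm w)\<^sup>2"
proof -
  have "(norm (A *v w))\<^sup>2 - (norm (B *v w))\<^sup>2 \<le> lambda_max (imbalance A B) * (norm w)\<^sup>2"
    using le_lambda_max[OF transpose_imbalance, of w A B] by (simp only: inner_imbalance)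
  also have "\<dots> \<le> lambda_plus A B * (norm w)\<^sup>2" by (intro mult_right_mono) (auto simp: lambda_plus_def)
  finally show ?thesis .
qed

text \<open>Positivity of \<open>a\<close> excludes both the default 0 for \<open>n > h\<close> and
  the clipping at 0. So \<open>a\<close> is the genuine n-th eigenvalue, at position
  \<open>n - 1\<close> counted from 0, and \<open>top_eigenspace\<close> gives dimension at least
  \<open>n\<close>.\<close>

lemma lambda_nth_pos_subspace:
  fixes A :: "real ^ 'h ^ 'n" and B :: "real ^ 'h ^ 'm"
  defines "a \<equiv> lambda_nth_pos CARD('n) (imbalance A B)"
  assumes "0 < a"
  shows "\<exists>S. subspace S \<and> CARD('n) \<le> dim S \<and>
    (\<forall>z\<in>S. \<forall>w. (a + lambda_minus A B) * (z \<bullet> w)\<^sup>2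
       \<le> (norm z)\<^sup>2 * ((norm (A *v w))\<^sup>2 - (norm (B *v w))\<^sup>2 + lambda_minus A B * (norm w)\<^sup>2))"
proof -
  let ?f = "(*v) (imbalance A B)"
  note sa = self_adjoint_matrix[OF transpose_imbalance, of A B]
  have n: "CARD('n) \<le> CARD('h)" and a: "a = eigenvalue_list ?f ! (CARD('n) - 1)"
    using assms unfolding a_def lambda_nth_pos_def lambda_nth_def by (auto split: if_splits)
  have "CARD('n) - 1 < DIM(real ^ 'h)" using n by (simp add: Suc_le_lessD)
  from top_eigenspace[OF sa this] obtain S where S: "subspace S" "?f ` S \<subseteq> S" "CARD('n) - 1 < dim S"
    "\<And>z. z \<in> S \<Longrightarrow> a * (norm z)\<^sup>2 \<le> z \<bullet> ?f z"
    unfolding a by metis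
  have neg: "- lambda_minus A B * (norm w)\<^sup>2 \<le> w \<bullet> ?f w" for w
    using imbalance_le_lambda_plus[of B w A] unfolding inner_imbalance lambda_plus_swap by simp
  have "0 \<le> a + lambda_minus A B" using assms by (simp add: lambda_minus_def)
  from invariant_subspace_form_ge[OF sa S(1,2,4) neg this] show ?thesis
    using S(1,3) unfolding inner_imbalance by (intro exI[of _ S]) auto
qed

lemma sigma_max_le:
  fixes M :: "real ^ 'm ^ 'n"
  assumes "\<And>x. norm (M *v x) \<le> c * norm x"
  shows "sigma_max M \<le> c"
proof -
  define p where "p = Max (eigenvalues ((*v) (transpose M ** M)))"
  obtain x where x: "norm x = 1" "transpose M *v (M *v x) = p *\<^sub>R x"
    using unit_gram_eigenvector[of p "transpose M"] Max_eigenvalues(1)[OF self_adjoint_gram[of M]]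
    unfolding p_def transpose_transpose by metis
  have "p = (norm (M *v x))\<^sup>2" using gram_eigenvector_norms(1)[of x "transpose M" p] x by simp
  then have "sigma_max M = norm (M *v x)" by (simp add: sigma_max_def mat_eigenvalues_def p_def)
  then show ?thesis using assms[of x] x(1) by simp
qed

text \<open>Carries the constants of the initialization over to a pair \<open>P\<close>,
  \<open>Q\<close> whose imbalance form has moved by at most \<open>e\<close>. The mixed products of
  the Gram lemmas are \<open>P Q^T\<close> and its transpose, which nearness to \<open>Wstar\<close>
  bounds between \<open>b1\<close> and \<open>b2\<close>. Each of \<open>P\<close> and
  \<open>Q\<close> contributes one \<open>e\<close>.\<close>

lemma sigma_T_perturbation:
  fixes A P :: "real ^ 'h ^ 'n" and B Q :: "real ^ 'h ^ 'm"
  assumes "0 \<le> e"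
    and pert: "\<And>w. \<bar>((norm (P *v w))\<^sup>2 - (norm (Q *v w))\<^sup>2) - ((norm (A *v w))\<^sup>2 - (norm (B *v w))\<^sup>2)\<bar>
      \<le> e * (norm w)\<^sup>2"
    and dist: "norm (P ** transpose Q - Wstar) \<le> sqrt (K / \<mu>) * norm (A ** transpose B - Wstar)"
  shows "alpha1 K \<mu> A B Wstar - 2 * e \<le> sigma_min_sq_T P Q"
    and "sigma_max_sq_T P Q \<le> alpha2 K \<mu> A B Wstar + 2 * e"
    and "sigma_max (P ** transpose Q) \<le> beta2 K \<mu> A B Wstar"
proof -
  let ?M = "P ** transpose Q"
  define b1 b2 where "b1 = beta1 K \<mu> A B Wstar" and "b2 = beta2 K \<mu> A B Wstar"
  define d where "d = sqrt (K / \<mu>) * norm (A ** transpose B - Wstar)"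
  have near: "norm (?M *v x - Wstar *v x) \<le> d * norm x" for x
    using norm_matrix_vector_le[of "?M - Wstar" x] mult_right_mono[OF dist norm_ge_zero[of x]]
    unfolding d_def matrix_vector_mult_diff_rdistrib by linarith
  have near': "norm (transpose ?M *v u - transpose Wstar *v u) \<le> d * norm u" for u
    using norm_matrix_vector_le[of "transpose (?M - Wstar)" u] mult_right_mono[OF dist norm_ge_zero[of u]]
    unfolding d_def matrix_vector_mult_diff_rdistrib[symmetric] transpose_diff[symmetric] norm_transpose by linarith
  have M2: "norm (?M *v x) \<le> b2 * norm x" for x
    using near[of x] norm_le_sigma_max[of Wstar x] norm_triangle_sub[of "?M *v x" "Wstar *v x"]
    unfolding b2_def beta2_def d_def distrib_right by linarith
  \<comment> \<open>Weyl's perturbation bound by the triangle inequality; clipping at 0 makes the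
    remaining case trivial.\<close>
  have M1: "b1 * norm x \<le> norm (?M *v x)" for x
  proof (cases "b1 = 0")
    case False
    then have "b1 = sigma_min Wstar - d" by (auto simp: b1_def beta1_def d_def max_def split: if_splits)
    then show ?thesis
      using near[of x] sigma_min_le_norm[of Wstar x] norm_triangle_sub[of "Wstar *v x" "?M *v x"]
      unfolding norm_minus_commute[of "Wstar *v x"] by (simp add: left_diff_distrib)
  qed simp
  have M1': "b1 * norm u \<le> norm (transpose ?M *v u)" for u
  proof (cases "b1 = 0")
    case False
    then have b1: "b1 = sigma_min Wstar - d" by (auto simp: b1_def beta1_def d_def max_def split: if_splits)
    show ?thesis
      using near'[of u] sigma_min_le_norm[of "transpose Wstar" u]
        norm_triangle_sub[of "transpose Wstar *v u" "transpose ?M *v u"]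
      unfolding norm_minus_commute[of "transpose Wstar *v u"] b1 sigma_min_transpose left_diff_distrib by linarith
  qed simp
  have QP: "Q *v (transpose P *v u) = transpose ?M *v u" for u
    by (simp only: matrix_vector_mul_assoc matrix_transpose_mul transpose_transpose)
  have PQ: "P *v (transpose Q *v u) = ?M *v u" for u
    by (simp only: matrix_vector_mul_assoc)
  have b1: "0 \<le> b1" by (simp add: b1_def beta1_def)
  define a where "a = lambda_nth_pos CARD('n) (imbalance A B)"
  define b where "b = lambda_nth_pos CARD('m) (imbalance B A)"
  have ab: "0 \<le> a" "0 \<le> b" by (simp_all add: a_def b_def lambda_nth_pos_def)
  define lp lm where "lp = lambda_plus A B" and "lm = lambda_minus A B"
  have l: "0 \<le> lp" "0 \<le> lm" by (simp_all add: lp_def lm_def lambda_plus_def lambda_minus_def)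
  have swap: "lambda_minus B A = lp" unfolding lp_def by (simp only: lambda_plus_swap[symmetric])
  have up: "(norm (A *v w))\<^sup>2 - (norm (B *v w))\<^sup>2 \<le> lp * (norm w)\<^sup>2"
    and down: "- lm * (norm w)\<^sup>2 \<le> (norm (A *v w))\<^sup>2 - (norm (B *v w))\<^sup>2" for w
    using imbalance_le_lambda_plus[of A w B] imbalance_le_lambda_plus[of B w A]
    unfolding lambda_plus_swap lp_def lm_def by simp_all
  have "((a - lm + sqrt ((a + lm)\<^sup>2 + 4 * b1\<^sup>2)) / 2 - e) * (norm v)\<^sup>2 \<le> (norm (transpose P *v v))\<^sup>2" for v
  proof (rule gram_lower_bound[where g = "\<lambda>w. (norm (A *v w))\<^sup>2 - (norm (B *v w))\<^sup>2" and Y = Q])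
    show "\<exists>S. subspace S \<and> CARD('n) \<le> dim S \<and> (\<forall>z\<in>S. \<forall>w. (a + lm) * (z \<bullet> w)\<^sup>2
       \<le> (norm z)\<^sup>2 * ((norm (A *v w))\<^sup>2 - (norm (B *v w))\<^sup>2 + lm * (norm w)\<^sup>2))" if "0 < a"
      using lambda_nth_pos_subspace[of A B] that unfolding a_def lm_def by blast
    show "((norm (A *v w))\<^sup>2 - (norm (B *v w))\<^sup>2) - e * (norm w)\<^sup>2 \<le> (norm (P *v w))\<^sup>2 - (norm (Q *v w))\<^sup>2" for w
      using pert[of w] by linarith
  qed (use ab l b1 \<open>0 \<le> e\<close> down M1' QP in simp_all)
  moreover have "((b - lp + sqrt ((b + lp)\<^sup>2 + 4 * b1\<^sup>2)) / 2 - e) * (norm v)\<^sup>2 \<le> (norm (transpose Q *v v))\<^sup>2" for v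
  proof (rule gram_lower_bound[where g = "\<lambda>w. (norm (B *v w))\<^sup>2 - (norm (A *v w))\<^sup>2" and Y = P])
    show "\<exists>S. subspace S \<and> CARD('m) \<le> dim S \<and> (\<forall>z\<in>S. \<forall>w. (b + lp) * (z \<bullet> w)\<^sup>2
       \<le> (norm z)\<^sup>2 * ((norm (B *v w))\<^sup>2 - (norm (A *v w))\<^sup>2 + lp * (norm w)\<^sup>2))" if "0 < b"
      using lambda_nth_pos_subspace[of B A] that unfolding b_def swap by blast
    show "((norm (B *v w))\<^sup>2 - (norm (A *v w))\<^sup>2) - e * (norm w)\<^sup>2 \<le> (norm (Q *v w))\<^sup>2 - (norm (P *v w))\<^sup>2" for w
      using pert[of w] by linarith
    show "- lp * (norm w)\<^sup>2 \<le> (norm (B *v w))\<^sup>2 - (norm (A *v w))\<^sup>2" for w using up[of w] by simp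
  qed (use ab l b1 \<open>0 \<le> e\<close> M1 PQ in simp_all)
  ultimately have "((a - lm + sqrt ((a + lm)\<^sup>2 + 4 * b1\<^sup>2)) / 2 - e)
      + ((b - lp + sqrt ((b + lp)\<^sup>2 + 4 * b1\<^sup>2)) / 2 - e) \<le> sigma_min_sq_T P Q"
    by (rule sigma_min_sq_T_ge)
  \<comment> \<open>Hence \<open>Delta_plus + Delta_low = lp + b\<close> and
    \<open>Delta_minus + Delta_low = lm + a\<close>: the first root in \<open>alpha1\<close> comes
    from \<open>Q\<close>, the second from \<open>P\<close>.\<close>
  moreover have "Delta_plus A B = lp - a" "Delta_minus A B = lm - b" "Delta_low A B = a + b"
    by (simp_all add: Delta_plus_def Delta_minus_def Delta_low_def uminus_imbalance a_def b_def lp_def lm_def)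
  ultimately show "alpha1 K \<mu> A B Wstar - 2 * e \<le> sigma_min_sq_T P Q"
    unfolding alpha1_def b1_def[symmetric] by (simp add: add.commute add_divide_distrib diff_divide_distrib)
  have "(norm (transpose P *v v))\<^sup>2 \<le> ((lp + sqrt (lp\<^sup>2 + 4 * b2\<^sup>2)) / 2 + e) * (norm v)\<^sup>2" for v
  proof (rule gram_upper_bound[where Y = Q])
    show "(norm (P *v w))\<^sup>2 - (norm (Q *v w))\<^sup>2 \<le> (lp + e) * (norm w)\<^sup>2" for w
      using pert[of w] up[of w] unfolding distrib_right by linarith
    show "norm (Q *v (transpose P *v u)) \<le> b2 * norm u" for u
      unfolding QP by (rule norm_transpose_vector_le[OF M2])
  qed (use l \<open>0 \<le> e\<close> in simp_all)
  moreover have "(norm (transpose Q *v v))\<^sup>2 \<le> ((lm + sqrt (lm\<^sup>2 + 4 * b2\<^sup>2)) / 2 + e) * (norm v)\<^sup>2" for v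
  proof (rule gram_upper_bound[where Y = P])
    show "(norm (Q *v w))\<^sup>2 - (norm (P *v w))\<^sup>2 \<le> (lm + e) * (norm w)\<^sup>2" for w
      using pert[of w] down[of w] unfolding distrib_right by linarith
    show "norm (P *v (transpose Q *v u)) \<le> b2 * norm u" for u
      unfolding PQ by (rule M2)
  qed (use l \<open>0 \<le> e\<close> in simp_all)
  ultimately have "sigma_max_sq_T P Q \<le> ((lp + sqrt (lp\<^sup>2 + 4 * b2\<^sup>2)) / 2 + e) + ((lm + sqrt (lm\<^sup>2 + 4 * b2\<^sup>2)) / 2 + e)"
    by (rule sigma_max_sq_T_le)
  then show "sigma_max_sq_T P Q \<le> alpha2 K \<mu> A B Wstar + 2 * e"
    unfolding alpha2_def b2_def lp_def lm_def by simp
  show "sigma_max ?M \<le> beta2 K \<mu> A B Wstar" using sigma_max_le[OF M2] by (simp add: b2_def)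
qed

text \<open>The case \<open>e = 0\<close> of the perturbation lemma at the initialization itself;
  its distance condition holds because \<open>K / \<mu>\<close> is at least 1.\<close>

lemma alpha2_nonneg:
  assumes "0 < \<mu>" "\<mu> \<le> K"
  shows "0 \<le> alpha2 K \<mu> A B Wstar"
proof -
  have "1 \<le> sqrt (K / \<mu>)" using assms by simp
  then have "norm (A ** transpose B - Wstar) \<le> sqrt (K / \<mu>) * norm (A ** transpose B - Wstar)"
    using mult_right_mono[of 1 "sqrt (K / \<mu>)" "norm (A ** transpose B - Wstar)"] by simp
  then have "sigma_max_sq_T A B \<le> alpha2 K \<mu> A B Wstar + 2 * 0"
    by (intro sigma_T_perturbation(2)) simp_all
  then show ?thesis
    using sigma_min_sq_T_nonneg[of A B] sigma_min_sq_T_le_max[of A B] by linarith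
qed

section \<open>One step of gradient descent\<close>

text \<open>The loss stays nonnegative at the minimizer \<open>V\<close> of the quadratic upper
  bound around \<open>W\<close>.\<close>

lemma power2_norm_gradient_le:
  assumes "smooth_const K l" "0 < K" "\<And>W. 0 \<le> l W"
  shows "(norm (gradient l W))\<^sup>2 \<le> 2 * K * l W"
proof -
  let ?g = "gradient l W"
  define V where "V = W - (1 / K) *\<^sub>R ?g"
  have "V - W = - (1 / K) *\<^sub>R ?g" by (simp add: V_def)
  moreover have "l V \<le> l W + ?g \<bullet> (V - W) + K / 2 * (norm (V - W))\<^sup>2"
    using assms(1) unfolding smooth_const_def by blast
  ultimately have "0 \<le> l W + ?g \<bullet> (- (1 / K) *\<^sub>R ?g) + K / 2 * (norm (- (1 / K) *\<^sub>R ?g))\<^sup>2"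
    using assms(3)[of V] by (simp only:)
  also have "\<dots> = l W - (norm ?g)\<^sup>2 / (2 * K)"
    using assms(2) by (simp add: power_mult_distrib power2_norm_eq_inner[symmetric] field_simps power2_eq_square)
  finally show ?thesis using assms(2) by (simp add: field_simps)
qed

text \<open>The Polyak-Lojasiewicz inequality: in strong convexity between \<open>W\<close> and
  \<open>Wstar\<close>, completing the square removes the inner product.\<close>

lemma strongly_convex_gradient_ge:
  assumes "strongly_convex \<mu> l" "l Wstar = 0"
  shows "2 * \<mu> * l W \<le> (norm (gradient l W))\<^sup>2"
proof -
  define g V where "g = gradient l W" and "V = Wstar - W"
  have \<mu>: "0 < \<mu>" using assms(1) by (simp add: strongly_convex_def)
  have "l Wstar \<ge> l W + g \<bullet> V + \<mu> / 2 * (norm V)\<^sup>2"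
    using assms(1) unfolding strongly_convex_def g_def V_def by blast
  with \<mu> assms(2) have "2 * \<mu> * (l W + g \<bullet> V + \<mu> / 2 * (norm V)\<^sup>2) \<le> 0"
    by (simp add: mult_le_0_iff)
  moreover have "0 \<le> (norm (g + \<mu> *\<^sub>R V))\<^sup>2" by simp
  moreover have "(norm (g + \<mu> *\<^sub>R V))\<^sup>2 = (norm g)\<^sup>2 + 2 * \<mu> * (g \<bullet> V) + \<mu> * \<mu> * (norm V)\<^sup>2"
    unfolding power2_norm_eq_inner inner_add_left inner_add_right inner_scaleR_left inner_scaleR_right
    by (simp add: inner_commute[of V g] algebra_simps)
  ultimately show ?thesis unfolding g_def[symmetric] by (simp add: algebra_simps)
qed

lemma strongly_convex_le_smooth_const:
  fixes l :: "'a::euclidean_space \<Rightarrow> real"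
  assumes "strongly_convex \<mu> l" "smooth_const K l"
  shows "\<mu> \<le> K"
proof -
  obtain b :: 'a where "b \<in> Basis" using nonempty_Basis by blast
  then have b: "norm (b - 0) = 1" by simp
  have "l 0 + gradient l 0 \<bullet> (b - 0) + \<mu> / 2 * (norm (b - 0))\<^sup>2 \<le> l b"
    using assms(1) unfolding strongly_convex_def by blast
  moreover have "l b \<le> l 0 + gradient l 0 \<bullet> (b - 0) + K / 2 * (norm (b - 0))\<^sup>2"
    using assms(2) unfolding smooth_const_def by blast
  ultimately show ?thesis unfolding b by simp
qed

section \<open>Descent of the loss and drift of the imbalance in one step\<close>

lemma matrix_mult_transpose_diff:
  fixes P X :: "real ^ 'h ^ 'n" and Q Y :: "real ^ 'h ^ 'm"
  shows "(P - \<eta> *\<^sub>R X) ** transpose (Q - \<eta> *\<^sub>R Y)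
    = P ** transpose Q - \<eta> *\<^sub>R (X ** transpose Q + P ** transpose Y) + \<eta>\<^sup>2 *\<^sub>R (X ** transpose Y)"
  by (simp add: vec_eq_iff matrix_matrix_mult_def transpose_def sum_distrib_left
      sum.distrib sum_subtractf algebra_simps power2_eq_square)

text \<open>The product changes by \<open>\<eta>^2 R - \<eta> Z\<close>, where \<open>Z\<close> is
  the adjoint of T applied to T of \<open>G\<close>, so the linear decrease is
  \<open>\<eta> \<tau>^2\<close>. All errors are multiples of \<open>\<tau>^2\<close>: in
  \<open>k\<close>, the term \<open>K * s\<close> pays for the square of \<open>Z\<close>,
  \<open>q\<close> for \<open>G\<close> with \<open>R\<close>, the term in \<open>\<eta>\<close> for
  \<open>R\<close> with \<open>Z\<close>, and the term in \<open>\<eta>^2\<close> for the square of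
  \<open>R\<close>.\<close>

lemma factored_descent:
  fixes l :: "real ^ 'm ^ 'n \<Rightarrow> real" and P :: "real ^ 'h ^ 'n" and Q :: "real ^ 'h ^ 'm"
  assumes sm: "smooth_const K l" and K: "0 < K" and l0: "\<And>W. 0 \<le> l W" and \<eta>: "0 \<le> \<eta>"
  defines "M \<equiv> P ** transpose Q"
  defines "G \<equiv> gradient l M"
  defines "s \<equiv> sigma_max_sq_T P Q" and "q \<equiv> sqrt (2 * K * l M)"
  defines "k \<equiv> K * s + q + 6 * K\<^sup>2 * sigma_max M * l M * \<eta>\<^sup>2 + 3 * K * s * q * \<eta>"
  shows "l ((P - \<eta> *\<^sub>R (G ** Q)) ** transpose (Q - \<eta> *\<^sub>R (transpose G ** P)))
    \<le> l M - (\<eta> - \<eta>\<^sup>2 / 2 * k) * (norm (T_op P Q G))\<^sup>2"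
proof -
  let ?X = "G ** Q" and ?Y = "transpose G ** P"
  define \<tau> where "\<tau> = norm (T_op P Q G)"
  define Z where "Z = ?X ** transpose Q + P ** transpose ?Y"
  define R where "R = ?X ** transpose ?Y"
  let ?M' = "(P - \<eta> *\<^sub>R ?X) ** transpose (Q - \<eta> *\<^sub>R ?Y)"
  have t0: "0 \<le> \<tau>" by (simp add: \<tau>_def)
  have \<tau>: "\<tau>\<^sup>2 = (norm ?X)\<^sup>2 + (norm ?Y)\<^sup>2" by (simp add: \<tau>_def power2_norm_T_op)
  have "0 \<le> 2 * K * l M" using K l0[of M] by simp
  then have q2: "q\<^sup>2 = 2 * K * l M" and q0: "0 \<le> q" by (simp_all add: q_def)
  have Gq: "norm G \<le> q"
    using power2_norm_gradient_le[OF sm K l0, of M] unfolding q_def G_def by (rule real_le_rsqrt)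
  have s0: "0 \<le> s" unfolding s_def by (rule order_trans[OF sigma_min_sq_T_nonneg sigma_min_sq_T_le_max])
  have TU: "norm (T_op P Q U) \<le> sqrt s * norm U" for U
    by (rule power2_le_imp_le)
      (use sigma_sq_T_bounds(2)[of P Q U] s0 in \<open>simp_all add: power_mult_distrib s_def\<close>)
  have Pt: "norm (transpose P *v u) \<le> sqrt s * norm u" for u
    by (rule power2_le_imp_le)
      (use power2_norm_le_sigma_max_sq_T(1)[of P u Q] s0 in \<open>simp_all add: power_mult_distrib s_def\<close>)
  have XY: "norm ?X * norm ?Y \<le> \<tau>\<^sup>2 / 2"
    using sum_squares_bound[of "norm ?X" "norm ?Y"] by (simp add: \<tau>)
  have Xt: "norm ?X \<le> \<tau>" by (rule power2_le_imp_le) (use \<tau> t0 in simp_all)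
  have diff: "?M' - M = \<eta>\<^sup>2 *\<^sub>R R - \<eta> *\<^sub>R Z"
    by (simp add: matrix_mult_transpose_diff M_def R_def Z_def)
  have inner_Z: "U \<bullet> Z = T_op P Q U \<bullet> T_op P Q G" for U
  proof -
    have "U \<bullet> (?X ** transpose Q) = (U ** Q) \<bullet> ?X" by (simp only: inner_matrix_mult_left)
    moreover have "U \<bullet> (P ** transpose ?Y) = (transpose U ** P) \<bullet> ?Y"
    proof -
      have "U \<bullet> (P ** transpose ?Y) = (P ** transpose ?Y) \<bullet> U" by (rule inner_commute)
      also have "\<dots> = transpose ?Y \<bullet> (transpose P ** U)" by (rule inner_matrix_mult_right)
      also have "\<dots> = ?Y \<bullet> (transpose U ** P)"
        by (metis inner_transpose_transpose matrix_transpose_mul transpose_transpose)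
      finally show ?thesis by (simp only: inner_commute)
    qed
    ultimately show ?thesis unfolding Z_def inner_T_op by (simp only: inner_add_right)
  qed
  have GZ: "G \<bullet> Z = \<tau>\<^sup>2" by (simp add: inner_Z \<tau>_def power2_norm_eq_inner)
  \<comment> \<open>The adjoint inherits the bound of T: take \<open>U = Z\<close> in
    \<open>inner_Z\<close> and cancel one factor.\<close>
  have Z: "norm Z \<le> sqrt s * \<tau>"
  proof -
    have "(norm Z)\<^sup>2 = T_op P Q Z \<bullet> T_op P Q G" by (simp only: power2_norm_eq_inner inner_Z)
    also have "\<dots> \<le> norm (T_op P Q Z) * \<tau>" unfolding \<tau>_def by (rule norm_cauchy_schwarz)
    also have "\<dots> \<le> sqrt s * norm Z * \<tau>" by (intro mult_right_mono TU t0)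
    finally have "norm Z * norm Z \<le> norm Z * (sqrt s * \<tau>)" by (simp add: power2_eq_square mult_ac)
    then show ?thesis using s0 t0 by (cases "Z = 0") (auto simp: mult_le_cancel_left)
  qed
  have GR: "G \<bullet> R \<le> q * (\<tau>\<^sup>2 / 2)"
  proof -
    have "G \<bullet> R \<le> norm G * norm R" by (rule norm_cauchy_schwarz)
    also have "\<dots> \<le> norm G * (norm ?X * norm ?Y)"
      unfolding R_def using norm_matrix_mult_le[of ?X "transpose ?Y"] by (intro mult_left_mono) (simp_all add: norm_transpose)
    also have "\<dots> \<le> q * (\<tau>\<^sup>2 / 2)" by (intro mult_mono Gq XY q0) auto
    finally show ?thesis .
  qed
  \<comment> \<open>\<open>R1\<close>, \<open>R2\<close> and \<open>R3\<close> bound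
    \<open>R\<close> with two, one and no powers of \<open>\<tau>\<close>, so that the products in
    \<open>ZR\<close> and \<open>RR\<close> carry exactly \<open>\<tau>^2\<close>.\<close>
  have R1: "norm R \<le> \<tau>\<^sup>2 / 2"
    unfolding R_def using norm_matrix_mult_le[of ?X "transpose ?Y"] XY by (simp add: norm_transpose)
  have tY: "transpose ?Y = transpose P ** G" by (simp add: matrix_transpose_mul)
  have R2: "norm R \<le> sqrt s * \<tau> * q"
  proof -
    have "norm R \<le> norm (?X ** transpose P) * norm G"
      unfolding R_def tY matrix_mul_assoc by (rule norm_matrix_mult_le)
    also have "\<dots> \<le> (sqrt s * norm ?X) * norm G"
      by (intro mult_right_mono norm_matrix_mult_le_right Pt) (use s0 in auto)
    also have "\<dots> \<le> (sqrt s * \<tau>) * q"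
      by (intro mult_mono mult_left_mono Xt Gq) (use s0 t0 in auto)
    finally show ?thesis .
  qed
  have R3: "norm R \<le> sigma_max M * q\<^sup>2"
  proof -
    \<comment> \<open>The middle factor \<open>Q P^T\<close> of \<open>R\<close> is
      \<open>transpose M\<close>, which brings in \<open>sigma_max M\<close>.\<close>
    have "R = G ** (transpose M ** G)"
      unfolding R_def tY M_def by (simp only: matrix_transpose_mul transpose_transpose matrix_mul_assoc)
    then have "norm R \<le> norm G * norm (transpose M ** G)" by (simp only: norm_matrix_mult_le)
    also have "\<dots> \<le> norm G * (sigma_max M * norm G)"
      by (intro mult_left_mono norm_matrix_mult_le_left norm_transpose_vector_le norm_le_sigma_max sigma_max_nonneg norm_ge_zero)
    also have "\<dots> = sigma_max M * (norm G)\<^sup>2" by (simp add: power2_eq_square)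
    also have "\<dots> \<le> sigma_max M * q\<^sup>2" by (intro mult_left_mono power_mono Gq sigma_max_nonneg) auto
    finally show ?thesis .
  qed
  have ZZ: "(norm Z)\<^sup>2 \<le> s * \<tau>\<^sup>2"
    using power_mono[OF Z norm_ge_zero, of 2] s0 by (simp add: power_mult_distrib)
  have ZR: "\<bar>R \<bullet> Z\<bar> \<le> s * \<tau>\<^sup>2 * q"
  proof -
    have "\<bar>R \<bullet> Z\<bar> \<le> norm R * norm Z" by (rule Cauchy_Schwarz_ineq2)
    also have "\<dots> \<le> (sqrt s * \<tau> * q) * (sqrt s * \<tau>)" by (intro mult_mono R2 Z) (use s0 t0 q0 in auto)
    also have "\<dots> = (sqrt s * sqrt s) * \<tau>\<^sup>2 * q" by (simp only: power2_eq_square mult_ac)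
    finally show ?thesis using s0 by simp
  qed
  have RR: "(norm R)\<^sup>2 \<le> sigma_max M * (2 * K * l M) * (\<tau>\<^sup>2 / 2)"
    unfolding power2_eq_square[of "norm R"] q2[symmetric]
    by (intro mult_mono R1 R3 mult_nonneg_nonneg sigma_max_nonneg) auto
  have norm_diff: "(norm (?M' - M))\<^sup>2 \<le> \<eta>\<^sup>2 * (s * \<tau>\<^sup>2) + 2 * \<eta> ^ 3 * (s * \<tau>\<^sup>2 * q)
      + \<eta> ^ 4 * (sigma_max M * (2 * K * l M) * (\<tau>\<^sup>2 / 2))"
  proof -
    have "(norm (?M' - M))\<^sup>2 = \<eta>\<^sup>2 * (norm Z)\<^sup>2 - 2 * \<eta> ^ 3 * (R \<bullet> Z) + \<eta> ^ 4 * (norm R)\<^sup>2"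
      unfolding diff power2_norm_eq_inner inner_diff_left inner_diff_right inner_scaleR_left inner_scaleR_right
        inner_commute[of Z R]
      by (simp add: algebra_simps power2_eq_square power3_eq_cube power4_eq_xxxx)
    also have "\<dots> \<le> \<eta>\<^sup>2 * (norm Z)\<^sup>2 + 2 * \<eta> ^ 3 * (s * \<tau>\<^sup>2 * q) + \<eta> ^ 4 * (norm R)\<^sup>2"
    proof -
      have "2 * \<eta> ^ 3 * (- (R \<bullet> Z)) \<le> 2 * \<eta> ^ 3 * (s * \<tau>\<^sup>2 * q)"
        by (rule mult_left_mono) (use ZR \<eta> in \<open>simp_all only: abs_le_iff zero_le_power mult_nonneg_nonneg zero_le_numeral\<close>)
      then show ?thesis unfolding mult_minus_right by linarith
    qed
    also have "\<dots> \<le> \<eta>\<^sup>2 * (s * \<tau>\<^sup>2) + 2 * \<eta> ^ 3 * (s * \<tau>\<^sup>2 * q)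
      + \<eta> ^ 4 * (sigma_max M * (2 * K * l M) * (\<tau>\<^sup>2 / 2))"
      by (intro add_mono mult_left_mono ZZ RR order_refl) (use \<eta> s0 in auto)
    finally show ?thesis .
  qed
  \<comment> \<open>The coefficients 3 and 6 in \<open>k\<close> exceed the 2 and 1 that arise here;
    these are the signs of the surplus.\<close>
  have extra: "0 \<le> K * s * q * \<eta> ^ 3 * \<tau>\<^sup>2" "0 \<le> K\<^sup>2 * sigma_max M * l M * \<eta> ^ 4 * \<tau>\<^sup>2"
    using K s0 q0 \<eta> sigma_max_nonneg[of M] l0[of M] by simp_all
  have "l ?M' \<le> l M + G \<bullet> (?M' - M) + K / 2 * (norm (?M' - M))\<^sup>2"
    using sm unfolding smooth_const_def G_def by blast
  also have "G \<bullet> (?M' - M) = \<eta>\<^sup>2 * (G \<bullet> R) - \<eta> * \<tau>\<^sup>2"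
    unfolding diff by (simp only: inner_diff_right inner_scaleR_right GZ)
  also have "l M + (\<eta>\<^sup>2 * (G \<bullet> R) - \<eta> * \<tau>\<^sup>2) + K / 2 * (norm (?M' - M))\<^sup>2
    \<le> l M + (\<eta>\<^sup>2 * (q * (\<tau>\<^sup>2 / 2)) - \<eta> * \<tau>\<^sup>2) + K / 2 * (\<eta>\<^sup>2 * (s * \<tau>\<^sup>2) + 2 * \<eta> ^ 3 * (s * \<tau>\<^sup>2 * q)
      + \<eta> ^ 4 * (sigma_max M * (2 * K * l M) * (\<tau>\<^sup>2 / 2)))"
    using K \<eta> by (intro add_mono diff_mono mult_left_mono GR norm_diff order_refl) auto
  also have "\<dots> = l M - (\<eta> - \<eta>\<^sup>2 / 2 * k) * \<tau>\<^sup>2 - K * s * q * \<eta> ^ 3 * \<tau>\<^sup>2 / 2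
      - 5 / 2 * (K\<^sup>2 * sigma_max M * l M * \<eta> ^ 4 * \<tau>\<^sup>2)"
    unfolding k_def by (simp add: field_simps power2_eq_square power3_eq_cube power4_eq_xxxx)
  also have "\<dots> \<le> l M - (\<eta> - \<eta>\<^sup>2 / 2 * k) * \<tau>\<^sup>2" using extra by linarith
  finally show ?thesis unfolding \<tau>_def .
qed

lemma power2_norm_diff_scaleR:
  fixes v x :: "'a::real_inner"
  shows "(norm (v - c *\<^sub>R x))\<^sup>2 = (norm v)\<^sup>2 - 2 * c * (v \<bullet> x) + c\<^sup>2 * (norm x)\<^sup>2"
  unfolding power2_norm_eq_inner by (simp add: inner_diff_left inner_diff_right inner_commute[of x v] power2_eq_square right_diff_distrib)

text \<open>The first-order changes of the two squared norms agree by \<open>cross\<close>, since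
  \<open>G\<close> enters one factor and its transpose the other; only the \<open>\<eta>^2\<close>
  terms remain.\<close>

lemma gd_step_imbalance:
  fixes P :: "real ^ 'h ^ 'n" and Q :: "real ^ 'h ^ 'm" and G :: "real ^ 'm ^ 'n"
    and \<eta> :: real
  defines "P' \<equiv> P - \<eta> *\<^sub>R (G ** Q)" and "Q' \<equiv> Q - \<eta> *\<^sub>R (transpose G ** P)"
  shows "\<bar>((norm (P' *v w))\<^sup>2 - (norm (Q' *v w))\<^sup>2) - ((norm (P *v w))\<^sup>2 - (norm (Q *v w))\<^sup>2)\<bar>
    \<le> \<eta>\<^sup>2 * (norm G)\<^sup>2 * sigma_max_sq_T P Q * (norm w)\<^sup>2"
proof -
  define x y where "x = G *v (Q *v w)" and "y = transpose G *v (P *v w)"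
  let ?s = "sigma_max_sq_T P Q"
  have s0: "0 \<le> ?s" by (rule order_trans[OF sigma_min_sq_T_nonneg sigma_min_sq_T_le_max])
  have op: "(norm (C *v w))\<^sup>2 \<le> ?s * (norm w)\<^sup>2"
    if "\<And>u. (norm (transpose C *v u))\<^sup>2 \<le> ?s * (norm u)\<^sup>2" for C :: "real ^ 'h ^ 'k"
  proof -
    have "norm (transpose C *v u) \<le> sqrt ?s * norm u" for u
      by (rule power2_le_imp_le) (use that[of u] s0 in \<open>simp_all add: power_mult_distrib\<close>)
    then have "norm (transpose (transpose C) *v w) \<le> sqrt ?s * norm w" by (rule norm_transpose_vector_le)
    then have "(norm (C *v w))\<^sup>2 \<le> (sqrt ?s * norm w)\<^sup>2" by (intro power_mono) auto
    then show ?thesis using s0 by (simp add: power_mult_distrib)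
  qed
  have GC: "(norm (H *v v))\<^sup>2 \<le> (norm G)\<^sup>2 * (?s * (norm w)\<^sup>2)"
    if "norm H = norm G" "(norm v)\<^sup>2 \<le> ?s * (norm w)\<^sup>2" for H :: "real ^ 'j ^ 'k" and v
  proof -
    have "(norm (H *v v))\<^sup>2 \<le> (norm H * norm v)\<^sup>2" by (intro power_mono norm_matrix_vector_le) auto
    also have "\<dots> \<le> (norm G)\<^sup>2 * (?s * (norm w)\<^sup>2)"
      unfolding power_mult_distrib that(1) by (intro mult_left_mono that) auto
    finally show ?thesis .
  qed
  have x: "(norm x)\<^sup>2 \<le> (norm G)\<^sup>2 * (?s * (norm w)\<^sup>2)"
    unfolding x_def by (intro GC refl op power2_norm_le_sigma_max_sq_T)
  have y: "(norm y)\<^sup>2 \<le> (norm G)\<^sup>2 * (?s * (norm w)\<^sup>2)"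
    unfolding y_def by (intro GC norm_transpose op power2_norm_le_sigma_max_sq_T)
  have cross: "(P *v w) \<bullet> x = (Q *v w) \<bullet> y"
    unfolding x_def y_def using inner_transpose_vector[of G "P *v w" "Q *v w"] by (simp only: inner_commute)
  have Pw: "P' *v w = P *v w - \<eta> *\<^sub>R x" and Qw: "Q' *v w = Q *v w - \<eta> *\<^sub>R y"
    unfolding P'_def Q'_def x_def y_def
    by (simp_all only: matrix_vector_mult_diff_rdistrib scaleR_matrix_vector_assoc[symmetric] matrix_vector_mul_assoc)
  have "((norm (P' *v w))\<^sup>2 - (norm (Q' *v w))\<^sup>2) - ((norm (P *v w))\<^sup>2 - (norm (Q *v w))\<^sup>2)
      = \<eta>\<^sup>2 * ((norm x)\<^sup>2 - (norm y)\<^sup>2)"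
    unfolding Pw Qw power2_norm_diff_scaleR cross by (simp add: algebra_simps)
  moreover have "\<bar>(norm x)\<^sup>2 - (norm y)\<^sup>2\<bar> \<le> (norm G)\<^sup>2 * (?s * (norm w)\<^sup>2)"
    using x y zero_le_power2[of "norm x"] zero_le_power2[of "norm y"] by linarith
  ultimately show ?thesis by (simp add: abs_mult mult.assoc mult_left_mono)
qed

text \<open>It suffices that \<open>x (2 - k0 x) <= \<eta> (2 - k \<eta>)\<close>. For
  \<open>\<eta> >= 2 x\<close> the condition \<open>k * \<eta> \<le> 1\<close> leaves at least
  \<open>\<eta>\<close> on the right. For smaller \<open>\<eta>\<close> the growth of
  \<open>k \<eta>^2\<close> since \<open>x\<close> is at most \<open>15 k0 x (\<eta> - x)\<close>,
  which the gain \<open>2 (\<eta> - x)\<close> covers.\<close>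

lemma rho_comparison:
  fixes a b c x \<eta> m m0 k0 :: real
  defines "k \<equiv> a + b * \<eta> + c * \<eta>\<^sup>2"
  assumes "0 \<le> a" "0 \<le> b" "0 \<le> c" "0 < x" "x \<le> \<eta>" and k: "k * \<eta> \<le> 1"
    and k0: "a + b * x + c * x\<^sup>2 \<le> k0" "15 * k0 * x \<le> 2" and m: "0 \<le> m0" "m0 \<le> m"
  shows "1 - 2 * m * \<eta> + m * k * \<eta>\<^sup>2 \<le> 1 - 2 * m0 * x + m0 * k0 * x\<^sup>2"
proof -
  have \<eta>: "\<eta> > 0" using assms by simp
  have "0 \<le> a + b * x + c * x\<^sup>2" using assms(2-5) by simp
  then have k0': "0 \<le> k0" using k0(1) by linarith
  have "\<eta> * 1 \<le> \<eta> * (2 - k * \<eta>)" using k \<eta> by (intro mult_left_mono) auto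
  then have ge: "\<eta> \<le> \<eta> * (2 - k * \<eta>)" by simp
  have "x * (2 - k0 * x) \<le> \<eta> * (2 - k * \<eta>)"
  proof (cases "2 * x \<le> \<eta>")
    case True
    have "x * (2 - k0 * x) \<le> x * 2" using k0' assms by (intro mult_left_mono) auto
    then show ?thesis using True ge by linarith
  next
    case False
    define d where "d = \<eta> - x"
    have d: "0 \<le> d" "d \<le> x" "\<eta> = x + d" using assms False by (auto simp: d_def)
    have p: "d * d \<le> x * d" "d * (d * d) \<le> x * (x * d)" "d * (d * (d * d)) \<le> x * (x * (x * d))"
      using d by (auto intro!: mult_mono)
    have p': "x * (d * d) \<le> x * (x * d)" "x * (x * (d * d)) \<le> x * (x * (x * d))" "x * (d * (d * d)) \<le> x * (x * (x * d))"
      using d by (auto intro!: mult_left_mono mult_mono)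
    \<comment> \<open>With \<open>\<eta> = x + d\<close> and \<open>d <= x\<close>, the j-th power
      grows by at most \<open>(2^j - 1) x^(j-1) d\<close>; \<open>j = 4\<close> is the source of the
      15.\<close>
    have e2: "\<eta>\<^sup>2 - x\<^sup>2 \<le> 3 * x * d"
      using p(1) unfolding d(3) by (simp add: power2_eq_square algebra_simps)
    have e3: "\<eta> ^ 3 - x ^ 3 \<le> 7 * x\<^sup>2 * d"
      using p(2) p'(1) unfolding d(3) by (simp add: power2_eq_square power3_eq_cube algebra_simps)
    have e4: "\<eta> ^ 4 - x ^ 4 \<le> 15 * x ^ 3 * d"
      using p(3) p'(2,3) unfolding d(3) by (simp add: power2_eq_square power3_eq_cube power4_eq_xxxx algebra_simps)
    have "a * (\<eta>\<^sup>2 - x\<^sup>2) + b * (\<eta> ^ 3 - x ^ 3) + c * (\<eta> ^ 4 - x ^ 4)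
        \<le> a * (3 * x * d) + b * (7 * x\<^sup>2 * d) + c * (15 * x ^ 3 * d)"
      by (intro add_mono mult_left_mono e2 e3 e4 assms)
    also have "\<dots> \<le> a * (15 * x * d) + b * (15 * x\<^sup>2 * d) + c * (15 * x ^ 3 * d)"
      using assms d by (intro add_mono mult_left_mono mult_right_mono) auto
    also have "\<dots> = 15 * (a + b * x + c * x\<^sup>2) * x * d"
      by (simp add: algebra_simps power2_eq_square power3_eq_cube)
    also have "\<dots> \<le> 15 * k0 * x * d" using k0(1) assms d by (intro mult_right_mono mult_left_mono) auto
    also have "\<dots> \<le> 2 * d" using k0(2) d by (intro mult_right_mono) auto
    finally have *: "a * (\<eta>\<^sup>2 - x\<^sup>2) + b * (\<eta> ^ 3 - x ^ 3) + c * (\<eta> ^ 4 - x ^ 4) \<le> 2 * \<eta> - 2 * x"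
      unfolding d_def by simp
    have "(a + b * x + c * x\<^sup>2) * x\<^sup>2 \<le> k0 * x\<^sup>2" using k0(1) by (rule mult_right_mono) simp
    with * show ?thesis
      by (simp add: k_def algebra_simps power2_eq_square power3_eq_cube power4_eq_xxxx)
  qed
  then have "m0 * (x * (2 - k0 * x)) \<le> m0 * (\<eta> * (2 - k * \<eta>))" using m by (intro mult_left_mono) auto
  also have "\<dots> \<le> m * (\<eta> * (2 - k * \<eta>))" using m ge \<eta> by (intro mult_right_mono) auto
  finally show ?thesis by (simp add: algebra_simps power2_eq_square)
qed

section \<open>Linear convergence\<close>

lemma W1_0: "W1 l \<eta> A B 0 = A" and W2_0: "W2 l \<eta> A B 0 = B"
  by (simp_all add: W1_def W2_def)

lemma W1_Suc: "W1 l \<eta> A B (Suc t)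
    = W1 l \<eta> A B t - \<eta> t *\<^sub>R (gradient l (Wprod l \<eta> A B t) ** W2 l \<eta> A B t)"
  and W2_Suc: "W2 l \<eta> A B (Suc t)
    = W2 l \<eta> A B t - \<eta> t *\<^sub>R (transpose (gradient l (Wprod l \<eta> A B t)) ** W1 l \<eta> A B t)"
  by (simp_all add: W1_def W2_def Wprod_def Let_def split_beta)

lemma loss_Wprod: "loss l \<eta> A B t = l (Wprod l \<eta> A B t)"
  by (simp add: loss_def factored_loss_def Wprod_def)

lemma loss_0: "loss l \<eta> A B 0 = factored_loss l A B"
  by (simp add: loss_def W1_0 W2_0)

lemma K_bar_0:
  "K_bar l K \<mu> A B Wstar x 0 = sqrt (2 * K * factored_loss l A B)
     + 6 * K\<^sup>2 * beta2 K \<mu> A B Wstar * factored_loss l A B * x\<^sup>2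
     + K * exp (sqrt x) * alpha2 K \<mu> A B Wstar * (1 + 3 * sqrt (2 * K * factored_loss l A B) * x)"
  by (simp add: K_bar_def K_bar_of_def Let_def)

lemma sum_power_le_inverse:
  fixes d c :: real
  assumes "0 \<le> d" "d \<le> 1 - c" "0 < c"
  shows "(\<Sum>s<t. d ^ s) \<le> 1 / c"
proof -
  have "c * (\<Sum>s<t. d ^ s) \<le> (1 - d) * (\<Sum>s<t. d ^ s)"
    using assms by (intro mult_right_mono sum_nonneg) auto
  also have "\<dots> = 1 - d ^ t" by (simp add: one_diff_power_eq)
  also have "\<dots> \<le> 1" using assms by simp
  finally show ?thesis using assms(3) by (simp add: field_simps)
qed

text \<open>\<open>e t\<close> bounds the accumulated drift of the imbalance. The hypotheses on
  \<open>x\<close> collect what smallness of the base step must provide, so the induction involves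
  no limits. \<open>Inv\<close> couples loss decay with drift because each step of either estimate
  needs the other.\<close>

lemma gd_invariant:
  fixes l :: "real ^ 'm ^ 'n \<Rightarrow> real" and A :: "real ^ 'h ^ 'n" and B :: "real ^ 'h ^ 'm"
  assumes sm: "smooth_const K l" and sc: "strongly_convex \<mu> l"
    and min: "\<And>W. 0 \<le> l W" "l Wstar = 0" and x: "0 < x"
  defines "L0 \<equiv> factored_loss l A B" and "E \<equiv> exp (sqrt x)" and "a2 \<equiv> alpha2 K \<mu> A B Wstar"
    and "r \<equiv> rho_bar l K \<mu> A B Wstar x x 0"
  defines "e \<equiv> \<lambda>t. 2 * K * L0 * (E * a2) * x\<^sup>2 * (\<Sum>s<t. ((1 + x\<^sup>2) * r) ^ s)"
  assumes mb: "0 \<le> mu_bar K \<mu> A B Wstar x" and r: "0 \<le> r" "r \<le> 1"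
    and e: "\<And>t. 2 * e t \<le> a2 * (E - 1)" and Kx: "15 * K_bar l K \<mu> A B Wstar x 0 * x \<le> 2"
    and step: "\<And>t. x \<le> \<eta> t" "\<And>t. \<eta> t \<le> (1 + x\<^sup>2) powr (real t / 2) * x" "\<And>t. \<eta> t \<le> 1 / K_loc l K \<eta> A B t"
  shows "mu_bar K \<mu> A B Wstar x \<le> mu_loc l \<mu> \<eta> A B t"
    and "mu_loc l \<mu> \<eta> A B t \<le> K_loc l K \<eta> A B t"
    and "K_loc l K \<eta> A B t \<le> K_bar l K \<mu> A B Wstar x t"
    and "loss l \<eta> A B (Suc t) \<le> loss l \<eta> A B t * rho l K \<mu> \<eta> A B t"
    and "loss l \<eta> A B t * rho l K \<mu> \<eta> A B t \<le> loss l \<eta> A B t * r"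
    and "loss l \<eta> A B (Suc t) \<le> loss l \<eta> A B 0 * r ^ Suc t"
proof -
  define P Q where "P = W1 l \<eta> A B" and "Q = W2 l \<eta> A B"
  define W where "W t = P t ** transpose (Q t)" for t
  define G where "G t = gradient l (W t)" for t
  define L where "L t = l (W t)" for t
  define Inv where "Inv t \<longleftrightarrow> L t \<le> L0 * r ^ t \<and>
    (\<forall>w. \<bar>((norm (P t *v w))\<^sup>2 - (norm (Q t *v w))\<^sup>2) - ((norm (A *v w))\<^sup>2 - (norm (B *v w))\<^sup>2)\<bar>
      \<le> e t * (norm w)\<^sup>2)" for t
  have \<mu>: "0 < \<mu>" using sc by (simp add: strongly_convex_def)
  have \<mu>K: "\<mu> \<le> K" by (rule strongly_convex_le_smooth_const[OF sc sm])
  then have K: "0 < K" using \<mu> by simp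
  note grad = power2_norm_gradient_le[OF sm K min(1)]
  have gstar: "gradient l Wstar = 0" using grad[of Wstar] min(2) by simp
  have lower: "\<mu> / 2 * (norm (V - Wstar))\<^sup>2 \<le> l V" and upper: "l V \<le> K / 2 * (norm (V - Wstar))\<^sup>2" for V
  proof -
    have "l Wstar + gradient l Wstar \<bullet> (V - Wstar) + \<mu> / 2 * (norm (V - Wstar))\<^sup>2 \<le> l V"
      using sc unfolding strongly_convex_def by blast
    then show "\<mu> / 2 * (norm (V - Wstar))\<^sup>2 \<le> l V" unfolding gstar min(2) by simp
    have "l V \<le> l Wstar + gradient l Wstar \<bullet> (V - Wstar) + K / 2 * (norm (V - Wstar))\<^sup>2"
      using sm unfolding smooth_const_def by blast
    then show "l V \<le> K / 2 * (norm (V - Wstar))\<^sup>2" unfolding gstar min(2) by simp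
  qed
  have L: "loss l \<eta> A B t = L t" for t by (simp add: L_def W_def P_def Q_def loss_Wprod Wprod_def)
  have L0': "L 0 = L0" unfolding L[symmetric] L0_def by (rule loss_0)
  have Lnn: "0 \<le> L t" for t unfolding L_def by (rule min)
  have L0: "0 \<le> L0" using Lnn[of 0] by (simp add: L0')
  have PS: "P (Suc t) = P t - \<eta> t *\<^sub>R (G t ** Q t)" and QS: "Q (Suc t) = Q t - \<eta> t *\<^sub>R (transpose (G t) ** P t)" for t
    unfolding P_def Q_def G_def W_def W1_Suc W2_Suc Wprod_def by simp_all
  have E: "1 \<le> E" using x by (simp add: E_def)
  have s0: "0 \<le> sigma_max_sq_T C D" for C :: "real ^ 'h ^ 'n" and D :: "real ^ 'h ^ 'm"
    by (rule order_trans[OF sigma_min_sq_T_nonneg sigma_min_sq_T_le_max])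
  have a2: "0 \<le> a2" unfolding a2_def by (rule alpha2_nonneg[OF \<mu> \<mu>K])
  define D where "D = (1 + x\<^sup>2) * r"
  have D: "0 \<le> D" using r(1) by (simp add: D_def)
  have enn: "0 \<le> e t" for t
    unfolding e_def D_def[symmetric] using K L0 E a2 D by (intro mult_nonneg_nonneg sum_nonneg) auto
  have \<eta>0: "0 < \<eta> t" for t using step(1)[of t] x by linarith
  have \<eta>2: "(\<eta> t)\<^sup>2 \<le> (1 + x\<^sup>2) ^ t * x\<^sup>2" for t
  proof -
    have pos: "0 < 1 + x\<^sup>2" by (simp add: add_pos_nonneg)
    have "((1 + x\<^sup>2) powr (real t / 2))\<^sup>2 = (1 + x\<^sup>2) powr real t"
      by (simp add: power2_eq_square flip: powr_add)
    also have "\<dots> = (1 + x\<^sup>2) ^ t" using pos by (rule powr_realpow)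
    finally have sq: "((1 + x\<^sup>2) powr (real t / 2))\<^sup>2 = (1 + x\<^sup>2) ^ t" .
    have "(\<eta> t)\<^sup>2 \<le> ((1 + x\<^sup>2) powr (real t / 2) * x)\<^sup>2"
      using step(2)[of t] \<eta>0[of t] by (intro power_mono) auto
    then show ?thesis by (simp only: power_mult_distrib sq)
  qed
  have main: "(mu_bar K \<mu> A B Wstar x \<le> mu_loc l \<mu> \<eta> A B t
      \<and> mu_loc l \<mu> \<eta> A B t \<le> K_loc l K \<eta> A B t
      \<and> K_loc l K \<eta> A B t \<le> K_bar l K \<mu> A B Wstar x t
      \<and> L (Suc t) \<le> L t * rho l K \<mu> \<eta> A B t
      \<and> L t * rho l K \<mu> \<eta> A B t \<le> L t * r) \<and> Inv (Suc t)" if Inv: "Inv t" for t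
  proof -
    define \<sigma> \<sigma>m \<sigma>W q where "\<sigma> = sigma_max_sq_T (P t) (Q t)" and "\<sigma>m = sigma_min_sq_T (P t) (Q t)"
      and "\<sigma>W = sigma_max (W t)" and "q = sqrt (2 * K * L t)"
    have Lt: "L t \<le> L0 * r ^ t" and imb: "\<And>w. \<bar>((norm (P t *v w))\<^sup>2 - (norm (Q t *v w))\<^sup>2)
        - ((norm (A *v w))\<^sup>2 - (norm (B *v w))\<^sup>2)\<bar> \<le> e t * (norm w)\<^sup>2"
      using Inv by (auto simp: Inv_def)
    have "L0 * r ^ t \<le> L0 * 1" using r L0 by (intro mult_left_mono power_le_one) auto
    with Lt have Lt0: "L t \<le> L0" by simp
    \<comment> \<open>Strong convexity bounds the distance by the loss, and smoothness bounds the
      initial loss by the initial distance; the quotient gives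
      \<open>sqrt (K / \<mu>)\<close>.\<close>
    have "norm (P t ** transpose (Q t) - Wstar) \<le> sqrt (K / \<mu>) * norm (A ** transpose B - Wstar)"
    proof (rule power2_le_imp_le)
      have "\<mu> / 2 * (norm (W t - Wstar))\<^sup>2 \<le> L t" unfolding L_def by (rule lower)
      also have "\<dots> \<le> K / 2 * (norm (A ** transpose B - Wstar))\<^sup>2"
        using Lt0 upper[of "A ** transpose B"] by (simp add: L0_def factored_loss_def)
      finally show "(norm (P t ** transpose (Q t) - Wstar))\<^sup>2 \<le> (sqrt (K / \<mu>) * norm (A ** transpose B - Wstar))\<^sup>2"
        using \<mu> K by (simp add: W_def power_mult_distrib field_simps)
    qed (use \<mu> K in simp)
    note pt = sigma_T_perturbation[OF enn imb this]
    have E1: "0 \<le> a2 * (E - 1)" using a2 E by simp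
    \<comment> \<open>The drift costs at most \<open>a2 * (E - 1)\<close>; \<open>mu_bar\<close>
      allows twice that loss.\<close>
    have \<sigma>m: "alpha1 K \<mu> A B Wstar + 2 * a2 * (1 - E) \<le> \<sigma>m"
      using pt(1) e[of t] E1 unfolding \<sigma>m_def by (simp add: algebra_simps)
    have \<sigma>: "0 \<le> \<sigma>" "\<sigma> \<le> E * a2"
      using pt(2) e[of t] s0[of "P t" "Q t"] unfolding \<sigma>_def a2_def[symmetric] by (simp_all add: algebra_simps)
    have \<sigma>W: "0 \<le> \<sigma>W" "\<sigma>W \<le> beta2 K \<mu> A B Wstar"
      using pt(3) sigma_max_nonneg unfolding \<sigma>W_def W_def by auto
    have q: "0 \<le> q" "q \<le> sqrt (2 * K * L0 * r ^ t)" "q \<le> sqrt (2 * K * L0)"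
      using K Lnn[of t] Lt Lt0 by (simp_all add: q_def mult.assoc)
    have mu: "mu_loc l \<mu> \<eta> A B t = \<mu> * \<sigma>m"
      by (simp add: mu_loc_def \<sigma>m_def P_def Q_def)
    define k where "k = K_loc l K \<eta> A B t"
    have k: "k = K * \<sigma> + q + 6 * K\<^sup>2 * \<sigma>W * L t * (\<eta> t)\<^sup>2 + 3 * K * \<sigma> * q * \<eta> t"
      unfolding k_def K_loc_def Let_def L by (simp add: \<sigma>_def q_def \<sigma>W_def W_def P_def Q_def Wprod_def)
    have 1: "mu_bar K \<mu> A B Wstar x \<le> \<mu> * \<sigma>m"
      using \<sigma>m \<mu> unfolding mu_bar_def a2_def E_def by (intro mult_left_mono) auto
    have \<sigma>m\<sigma>: "0 \<le> \<sigma>m" "\<sigma>m \<le> \<sigma>" unfolding \<sigma>m_def \<sigma>_def by (rule sigma_min_sq_T_nonneg sigma_min_sq_T_le_max)+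
    have "\<mu> * \<sigma>m \<le> K * \<sigma>" using \<mu>K \<sigma>m\<sigma> K by (intro mult_mono) auto
    moreover have "0 \<le> 6 * K\<^sup>2 * \<sigma>W * L t * (\<eta> t)\<^sup>2" "0 \<le> 3 * K * \<sigma> * q * \<eta> t"
      using K \<sigma>W Lnn[of t] \<sigma> q \<eta>0[of t] by (auto intro!: mult_nonneg_nonneg)
    ultimately have 2: "\<mu> * \<sigma>m \<le> k" unfolding k using q(1) by linarith
    have k\<eta>: "k * \<eta> t \<le> 1"
    proof -
      \<comment> \<open>A positive step at most \<open>1 / k\<close> forces \<open>k\<close> to be
        positive, as \<open>1 / 0 = 0\<close>.\<close>
      have "0 < 1 / k" using step(3)[of t] \<eta>0[of t] unfolding k_def by linarith
      then have "0 < k" by simp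
      then show ?thesis using step(3)[of t] unfolding k_def[symmetric] by (simp add: field_simps)
    qed
    \<comment> \<open>The decay \<open>r ^ t\<close> of the loss and the growth
      \<open>(1 + x^2) ^ t\<close> of the squared steps combine into \<open>D ^ t\<close>.\<close>
    have q\<eta>: "q * \<eta> t \<le> sqrt (2 * K * L0 * D ^ t) * x"
    proof (rule power2_le_imp_le)
      have "(q * \<eta> t)\<^sup>2 = 2 * K * L t * (\<eta> t)\<^sup>2"
        using K Lnn[of t] by (simp add: q_def power_mult_distrib)
      also have "\<dots> \<le> 2 * K * (L0 * r ^ t) * ((1 + x\<^sup>2) ^ t * x\<^sup>2)"
        using K Lnn[of t] L0 r by (intro mult_mono mult_left_mono Lt \<eta>2) auto
      also have "\<dots> = (sqrt (2 * K * L0 * D ^ t) * x)\<^sup>2"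
      proof -
        have "(sqrt (2 * K * L0 * D ^ t))\<^sup>2 = 2 * K * L0 * D ^ t" using K L0 D by simp
        then show ?thesis by (simp add: power_mult_distrib D_def mult_ac)
      qed
      finally show "(q * \<eta> t)\<^sup>2 \<le> (sqrt (2 * K * L0 * D ^ t) * x)\<^sup>2" .
    qed (use K L0 D x in auto)
    have L\<eta>: "L t * (\<eta> t)\<^sup>2 \<le> L0 * x\<^sup>2 * D ^ t"
    proof -
      have "L t * (\<eta> t)\<^sup>2 \<le> (L0 * r ^ t) * ((1 + x\<^sup>2) ^ t * x\<^sup>2)"
        using Lnn[of t] L0 r by (intro mult_mono Lt \<eta>2) auto
      then show ?thesis by (simp add: D_def power_mult_distrib mult_ac)
    qed
    have 3: "k \<le> K_bar l K \<mu> A B Wstar x t"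
    proof -
      have "6 * K\<^sup>2 * \<sigma>W * (L t * (\<eta> t)\<^sup>2) \<le> 6 * K\<^sup>2 * beta2 K \<mu> A B Wstar * (L0 * x\<^sup>2 * D ^ t)"
        using K \<sigma>W Lnn[of t] by (intro mult_mono mult_left_mono L\<eta>) auto
      moreover have "3 * K * \<sigma> * (q * \<eta> t) \<le> 3 * K * (E * a2) * (sqrt (2 * K * L0 * D ^ t) * x)"
        using K \<sigma> q(1) \<eta>0[of t] by (intro mult_mono mult_left_mono q\<eta>) auto
      moreover have "K * \<sigma> \<le> K * (E * a2)" using K \<sigma> by (intro mult_left_mono) auto
      ultimately have "k \<le> K * (E * a2) + sqrt (2 * K * L0 * r ^ t)
          + 6 * K\<^sup>2 * beta2 K \<mu> A B Wstar * (L0 * x\<^sup>2 * D ^ t) + 3 * K * (E * a2) * (sqrt (2 * K * L0 * D ^ t) * x)"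
        unfolding k using q(2) by (simp only: mult.assoc)
      also have "\<dots> = K_bar l K \<mu> A B Wstar x t"
        unfolding K_bar_eq Let_def L0_def[symmetric] E_def[symmetric] a2_def[symmetric] r_def[symmetric] D_def[symmetric]
        by (simp add: algebra_simps)
      finally show ?thesis .
    qed
    have rho: "rho l K \<mu> \<eta> A B t = 1 - 2 * (\<mu> * \<sigma>m) * \<eta> t + \<mu> * \<sigma>m * k * (\<eta> t)\<^sup>2"
      by (simp add: rho_def mu k_def)
    have "rho l K \<mu> \<eta> A B t \<le> r"
    proof -
      \<comment> \<open>As a polynomial in the step, \<open>k\<close> has coefficients fixed by the
        iterate. At the step \<open>x\<close> its value is below \<open>K_bar\<close> at time 0
        because \<open>L t \<le> L0\<close>, whence one rate \<open>r\<close> for all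
        \<open>t\<close>.\<close>
      define a b c where "a = K * \<sigma> + q" and "b = 3 * K * \<sigma> * q" and "c = 6 * K\<^sup>2 * \<sigma>W * L t"
      have k': "k = a + b * \<eta> t + c * (\<eta> t)\<^sup>2" by (simp add: k a_def b_def c_def)
      have nn: "0 \<le> a" "0 \<le> b" "0 \<le> c" using K \<sigma> q(1) \<sigma>W Lnn[of t] by (simp_all add: a_def b_def c_def)
      have "c * x\<^sup>2 \<le> 6 * K\<^sup>2 * beta2 K \<mu> A B Wstar * L0 * x\<^sup>2"
        unfolding c_def using K \<sigma>W Lnn[of t] by (intro mult_mono mult_left_mono mult_right_mono Lt0) auto
      moreover have "b * x \<le> 3 * K * (E * a2) * sqrt (2 * K * L0) * x"
        unfolding b_def using K \<sigma> q x by (intro mult_mono mult_left_mono mult_right_mono) auto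
      moreover have "K * \<sigma> \<le> K * (E * a2)" using K \<sigma> by (intro mult_left_mono) auto
      ultimately have "a + b * x + c * x\<^sup>2 \<le> K * (E * a2) + sqrt (2 * K * L0)
          + 3 * K * (E * a2) * sqrt (2 * K * L0) * x + 6 * K\<^sup>2 * beta2 K \<mu> A B Wstar * L0 * x\<^sup>2"
        unfolding a_def using q(3) by linarith
      also have "\<dots> = K_bar l K \<mu> A B Wstar x 0"
        unfolding K_bar_0 L0_def[symmetric] E_def[symmetric] a2_def[symmetric] by (simp add: algebra_simps)
      finally have "a + b * x + c * x\<^sup>2 \<le> K_bar l K \<mu> A B Wstar x 0" .
      then have "1 - 2 * (\<mu> * \<sigma>m) * \<eta> t + \<mu> * \<sigma>m * (a + b * \<eta> t + c * (\<eta> t)\<^sup>2) * (\<eta> t)\<^sup>2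
        \<le> 1 - 2 * mu_bar K \<mu> A B Wstar x * x + mu_bar K \<mu> A B Wstar x * K_bar l K \<mu> A B Wstar x 0 * x\<^sup>2"
        using k\<eta> unfolding k' by (intro rho_comparison nn x step(1) Kx mb 1) auto
      then show ?thesis unfolding rho k' r_def rho_bar_def .
    qed
    then have 5: "L t * rho l K \<mu> \<eta> A B t \<le> L t * r" by (intro mult_left_mono Lnn)
    have 4: "L (Suc t) \<le> L t * rho l K \<mu> \<eta> A B t"
    proof -
      define g where "g = (norm (T_op (P t) (Q t) (G t)))\<^sup>2"
      have "L (Suc t) \<le> L t - (\<eta> t - (\<eta> t)\<^sup>2 / 2 * k) * g"
        unfolding L_def W_def[of "Suc t"] PS QS k
        using factored_descent[OF sm K min(1), of "\<eta> t" "P t" "Q t"] \<eta>0[of t]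
        by (simp add: G_def W_def g_def \<sigma>_def q_def L_def \<sigma>W_def)
      moreover have "(\<eta> t - (\<eta> t)\<^sup>2 / 2 * k) * (\<sigma>m * (2 * \<mu> * L t)) \<le> (\<eta> t - (\<eta> t)\<^sup>2 / 2 * k) * g"
      proof (rule mult_left_mono)
        have "\<sigma>m * (2 * \<mu> * L t) \<le> \<sigma>m * (norm (G t))\<^sup>2"
          unfolding L_def G_def
          by (intro mult_left_mono strongly_convex_gradient_ge[OF sc min(2)] \<sigma>m\<sigma>)
        also have "\<dots> \<le> g" unfolding g_def \<sigma>m_def by (rule sigma_sq_T_bounds)
        finally show "\<sigma>m * (2 * \<mu> * L t) \<le> g" .
        have "\<eta> t * (k * \<eta> t) \<le> \<eta> t * 1" using k\<eta> \<eta>0[of t] by (intro mult_left_mono) auto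
        then show "0 \<le> \<eta> t - (\<eta> t)\<^sup>2 / 2 * k" using \<eta>0[of t] by (simp add: power2_eq_square mult_ac)
      qed
      ultimately have "L (Suc t) \<le> L t - (\<eta> t - (\<eta> t)\<^sup>2 / 2 * k) * (\<sigma>m * (2 * \<mu> * L t))" by linarith
      also have "\<dots> = L t * rho l K \<mu> \<eta> A B t" unfolding rho by (simp add: algebra_simps)
      finally show ?thesis .
    qed
    have "L (Suc t) \<le> L0 * r ^ Suc t"
      using 4 5 mult_right_mono[OF Lt r(1)] by (simp add: mult_ac)
    moreover have "\<bar>((norm (P (Suc t) *v w))\<^sup>2 - (norm (Q (Suc t) *v w))\<^sup>2)
        - ((norm (A *v w))\<^sup>2 - (norm (B *v w))\<^sup>2)\<bar> \<le> e (Suc t) * (norm w)\<^sup>2" for w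
    proof -
      \<comment> \<open>The drift of this step fits into the next summand of
        \<open>e\<close>.\<close>
      have "(\<eta> t)\<^sup>2 * (norm (G t))\<^sup>2 * \<sigma> \<le> (\<eta> t)\<^sup>2 * (2 * K * L t) * (E * a2)"
        using grad[of "W t"] K Lnn[of t] \<sigma> unfolding G_def L_def by (intro mult_mono mult_left_mono) auto
      also have "\<dots> = 2 * K * (E * a2) * (L t * (\<eta> t)\<^sup>2)" by (simp add: mult_ac)
      also have "\<dots> \<le> 2 * K * (E * a2) * (L0 * x\<^sup>2 * D ^ t)"
        using K E a2 by (intro mult_left_mono L\<eta>) auto
      also have "\<dots> = e (Suc t) - e t" by (simp add: e_def D_def algebra_simps)
      finally have "(\<eta> t)\<^sup>2 * (norm (G t))\<^sup>2 * \<sigma> * (norm w)\<^sup>2 \<le> (e (Suc t) - e t) * (norm w)\<^sup>2"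
        by (intro mult_right_mono) auto
      moreover have "\<bar>((norm (P (Suc t) *v w))\<^sup>2 - (norm (Q (Suc t) *v w))\<^sup>2)
          - ((norm (P t *v w))\<^sup>2 - (norm (Q t *v w))\<^sup>2)\<bar> \<le> (\<eta> t)\<^sup>2 * (norm (G t))\<^sup>2 * \<sigma> * (norm w)\<^sup>2"
        unfolding PS QS \<sigma>_def by (rule gd_step_imbalance)
      ultimately show ?thesis using imb[of w] unfolding left_diff_distrib by linarith
    qed
    ultimately have "Inv (Suc t)" by (simp add: Inv_def)
    then show ?thesis using 1 2 3 4 5 unfolding mu k_def by blast
  qed
  have "Inv 0" by (simp add: Inv_def L0' e_def P_def Q_def W1_0 W2_0)
  then have Inv: "Inv t" for t by (induction t) (use main in blast)+
  from main[OF Inv, of t]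
  show "mu_bar K \<mu> A B Wstar x \<le> mu_loc l \<mu> \<eta> A B t"
    and "mu_loc l \<mu> \<eta> A B t \<le> K_loc l K \<eta> A B t"
    and "K_loc l K \<eta> A B t \<le> K_bar l K \<mu> A B Wstar x t"
    and "loss l \<eta> A B (Suc t) \<le> loss l \<eta> A B t * rho l K \<mu> \<eta> A B t"
    and "loss l \<eta> A B t * rho l K \<mu> \<eta> A B t \<le> loss l \<eta> A B t * r"
    unfolding L by blast+
  show "loss l \<eta> A B (Suc t) \<le> loss l \<eta> A B 0 * r ^ Suc t"
    using Inv[of "Suc t"] unfolding Inv_def L L0' by blast
qed

text \<open>For small \<open>x\<close> the ratio \<open>(1 + x^2) * r x\<close> is at most
  \<open>1 - c * x\<close>, so the geometric sum is at most \<open>1 / (c * x)\<close> and the drift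
  is of order \<open>x\<close>, while the slack \<open>exp (sqrt x) - 1\<close> is at least
  \<open>sqrt x\<close>.\<close>

lemma eventually_step_conditions:
  fixes l :: "real ^ 'm ^ 'n \<Rightarrow> real" and A :: "real ^ 'h ^ 'n" and B :: "real ^ 'h ^ 'm"
    and Wstar :: "real ^ 'm ^ 'n" and K \<mu> :: real
  defines "L0 \<equiv> factored_loss l A B" and "a1 \<equiv> alpha1 K \<mu> A B Wstar" and "a2 \<equiv> alpha2 K \<mu> A B Wstar"
    and "mb \<equiv> mu_bar K \<mu> A B Wstar" and "r \<equiv> \<lambda>x. rho_bar l K \<mu> A B Wstar x x 0"
    and "Kb \<equiv> \<lambda>x. K_bar l K \<mu> A B Wstar x 0"
  assumes \<mu>: "0 < \<mu>" "0 < K" "0 \<le> L0" "0 < a1" "0 \<le> a2" "0 \<le> beta2 K \<mu> A B Wstar"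
  shows "\<forall>\<^sub>F x in at_right 0. 0 \<le> mb x \<and> 0 \<le> r x \<and> r x \<le> 1 \<and> 15 * Kb x * x \<le> 2 \<and>
    (\<forall>t. 2 * (2 * K * L0 * (exp (sqrt x) * a2) * x\<^sup>2 * (\<Sum>s<t. ((1 + x\<^sup>2) * r x) ^ s)) \<le> a2 * (exp (sqrt x) - 1))"
proof -
  \<comment> \<open>A quarter of the limit of \<open>mb\<close>, so that \<open>mb x\<close>
    eventually lies between \<open>2 * c\<close> and \<open>5 * c\<close>.\<close>
  define c where "c = \<mu> * a1 / 4"
  have c: "0 < c" using \<mu> by (simp add: c_def)
  have id: "((\<lambda>x::real. x) \<longlongrightarrow> 0) (at_right 0)" by (rule tendsto_ident_at)
  have E: "((\<lambda>x. exp (sqrt x)) \<longlongrightarrow> 1) (at_right 0)"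
    by (rule tendsto_eq_intros id | simp)+
  have mb: "(mb \<longlongrightarrow> \<mu> * a1) (at_right 0)"
    unfolding mb_def mu_bar_def[abs_def] a1_def by (rule tendsto_eq_intros E | simp)+
  have Kb: "((\<lambda>x. 15 * Kb x * x) \<longlongrightarrow> 0) (at_right 0)"
    unfolding Kb_def K_bar_0 by (rule tendsto_eq_intros id E | simp)+
  \<comment> \<open>What remains of the drift bound, up to \<open>a2\<close> and \<open>c\<close>,
    after one factor \<open>sqrt x\<close> is split off.\<close>
  have q: "((\<lambda>x. 4 * K * L0 * exp (sqrt x) * sqrt x) \<longlongrightarrow> 0) (at_right 0)"
    by (rule tendsto_eq_intros id E | simp)+
  have "\<forall>\<^sub>F x in at_right 0. 2 * c < mb x" using order_tendstoD(1)[OF mb, of "2 * c"] c by (simp add: c_def)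
  moreover have "\<forall>\<^sub>F x in at_right 0. mb x < 5 * c" using order_tendstoD(2)[OF mb, of "5 * c"] c by (simp add: c_def)
  moreover have "\<forall>\<^sub>F x in at_right 0. 15 * Kb x * x < 2" using order_tendstoD(2)[OF Kb, of 2] by simp
  moreover have "\<forall>\<^sub>F x in at_right 0. 4 * K * L0 * exp (sqrt x) * sqrt x < c" using order_tendstoD(2)[OF q c] .
  moreover have "\<forall>\<^sub>F x in at_right 0. x < c" using order_tendstoD(2)[OF id c] .
  moreover have "\<forall>\<^sub>F x in at_right 0. x < 1 / (10 * c)" using order_tendstoD(2)[OF id, of "1 / (10 * c)"] c by simp
  moreover have "\<forall>\<^sub>F x :: real in at_right 0. 0 < x" by (rule eventually_at_right_less)
  ultimately show ?thesis
  proof eventually_elim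
    case (elim x)
    note x = elim(7)
    define E where "E = exp (sqrt x)"
    have E: "sqrt x \<le> E - 1" "1 \<le> E" using exp_ge_add_one_self[of "sqrt x"] x by (simp_all add: E_def del: exp_ge_add_one_self)
    have rx: "r x = 1 - 2 * mb x * x + mb x * Kb x * x\<^sup>2"
      by (simp add: r_def rho_bar_def mb_def Kb_def)
    have mb0: "0 < mb x" using elim(1) c by linarith
    have Kb0: "0 \<le> Kb x" unfolding Kb_def K_bar_0 using \<mu> x by (auto simp: L0_def a2_def)
    have "mb x * x \<le> 5 * c * (1 / (10 * c))" using elim(2,6) mb0 x c by (intro mult_mono) auto
    then have "2 * mb x * x \<le> 1" using c by simp
    moreover have "0 \<le> mb x * Kb x * x\<^sup>2" using mb0 Kb0 by simp
    ultimately have r0: "0 \<le> r x" unfolding rx by linarith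
    \<comment> \<open>The quadratic term of \<open>r x\<close> uses at most 2/15 of
      \<open>mb x * x\<close>, so a decrease of at least \<open>2 * c * x\<close> remains.\<close>
    have "mb x * x * (15 * Kb x * x) \<le> mb x * x * 2" using elim(3) mb0 x by (intro mult_left_mono) auto
    then have "15 * (mb x * Kb x * x\<^sup>2) \<le> 2 * (mb x * x)" by (simp add: power2_eq_square mult_ac)
    moreover have "2 * c * x \<le> mb x * x" using elim(1) x by (intro mult_right_mono) auto
    moreover have "0 < c * x" using c x by simp
    ultimately have r1: "r x \<le> 1 - 2 * c * x" "r x \<le> 1" unfolding rx by linarith+
    \<comment> \<open>The factor \<open>1 + x^2\<close> costs at most \<open>c * x\<close>, half of
      that decrease.\<close>
    have "x * x \<le> c * x" using elim(5) x by (intro mult_right_mono) auto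
    moreover have "x\<^sup>2 * r x \<le> x\<^sup>2 * 1" by (intro mult_left_mono r1) auto
    ultimately have D1: "(1 + x\<^sup>2) * r x \<le> 1 - c * x" using r1(1) by (simp add: power2_eq_square algebra_simps)
    have sum: "2 * (2 * K * L0 * (E * a2) * x\<^sup>2 * (\<Sum>s<t. ((1 + x\<^sup>2) * r x) ^ s)) \<le> a2 * (E - 1)" for t
    proof -
      have "2 * (2 * K * L0 * (E * a2) * x\<^sup>2 * (\<Sum>s<t. ((1 + x\<^sup>2) * r x) ^ s))
          \<le> 2 * (2 * K * L0 * (E * a2) * x\<^sup>2 * (1 / (c * x)))"
        using \<mu> E r0 D1 c x by (intro mult_left_mono sum_power_le_inverse) auto
      also have "\<dots> = a2 * ((4 * K * L0 * E * sqrt x) * (sqrt x / c))"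
        using x c by (simp add: power2_eq_square field_simps)
      also have "\<dots> \<le> a2 * (c * (sqrt x / c))"
        using elim(4) \<mu> c x unfolding E_def by (intro mult_left_mono mult_right_mono) auto
      also have "\<dots> \<le> a2 * (E - 1)" using E \<mu> c by (intro mult_left_mono) auto
      finally show ?thesis .
    qed
    show ?case using mb0 r0 r1(2) elim(3) sum unfolding E_def by auto
  qed
qed

theorem theorem3p2:
  fixes l :: "real ^ 'm ^ 'n \<Rightarrow> real"
    and A :: "real ^ 'h ^ 'n" and B :: "real ^ 'h ^ 'm"
    and Wstar :: "real ^ 'm ^ 'n"
    and K \<mu> :: real
  assumes "twice_differentiable l"
    and "smooth_const K l"
    and "strongly_convex \<mu> l"
    and "\<forall>W. l Wstar \<le> l W"
    and "l Wstar = 0"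
    and "min CARD('m) CARD('n) \<le> CARD('h)"
    and "alpha1 K \<mu> A B Wstar > 0"
  shows "\<exists>\<eta>max>0. \<forall>\<eta>0. 0 < \<eta>0 \<and> \<eta>0 < \<eta>max \<longrightarrow>
    (\<forall>\<eta> :: nat \<Rightarrow> real.
      (\<forall>t. \<eta>0 \<le> \<eta> t \<and>
           \<eta> t \<le> min ((1 + \<eta>0\<^sup>2) powr (real t / 2) * \<eta>0) (1 / K_loc l K \<eta> A B t)) \<longrightarrow>
      (\<forall>t.
        mu_bar K \<mu> A B Wstar \<eta>0 \<le> mu_loc l \<mu> \<eta> A B t \<and>
        mu_loc l \<mu> \<eta> A B t \<le> K_loc l K \<eta> A B t \<and>
        K_loc l K \<eta> A B t \<le> K_bar l K \<mu> A B Wstar \<eta>0 t \<and>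
        loss l \<eta> A B (Suc t) \<le> loss l \<eta> A B t * rho l K \<mu> \<eta> A B t \<and>
        loss l \<eta> A B t * rho l K \<mu> \<eta> A B t
          \<le> loss l \<eta> A B t * rho_bar l K \<mu> A B Wstar \<eta>0 \<eta>0 0 \<and>
        loss l \<eta> A B (Suc t) \<le> loss l \<eta> A B 0 * rho_bar l K \<mu> A B Wstar \<eta>0 \<eta>0 0 ^ (Suc t)))"
proof -
  have min: "0 \<le> l W" for W using assms(4,5) by simp
  have \<mu>: "0 < \<mu>" using assms(3) by (simp add: strongly_convex_def)
  have \<mu>K: "\<mu> \<le> K" by (rule strongly_convex_le_smooth_const[OF assms(3,2)])
  then have K: "0 < K" using \<mu> by simp
  note a2 = alpha2_nonneg[OF \<mu> \<mu>K, of A B Wstar]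
  have b2: "0 \<le> beta2 K \<mu> A B Wstar"
    unfolding beta2_def using \<mu> K by (intro add_nonneg_nonneg sigma_max_nonneg) auto
  have L0: "0 \<le> factored_loss l A B" unfolding factored_loss_def by (rule min)
  \<comment> \<open>\<open>b\<close> serves as the threshold; it is fixed before any step sizes are
    chosen.\<close>
  obtain b where b: "b > 0" "\<And>x. 0 < x \<Longrightarrow> x < b \<Longrightarrow>
      0 \<le> mu_bar K \<mu> A B Wstar x \<and> 0 \<le> rho_bar l K \<mu> A B Wstar x x 0 \<and> rho_bar l K \<mu> A B Wstar x x 0 \<le> 1
      \<and> 15 * K_bar l K \<mu> A B Wstar x 0 * x \<le> 2 \<and>
      (\<forall>t. 2 * (2 * K * factored_loss l A B * (exp (sqrt x) * alpha2 K \<mu> A B Wstar) * x\<^sup>2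
         * (\<Sum>s<t. ((1 + x\<^sup>2) * rho_bar l K \<mu> A B Wstar x x 0) ^ s)) \<le> alpha2 K \<mu> A B Wstar * (exp (sqrt x) - 1))"
    using eventually_step_conditions[OF \<mu> K L0 assms(7) a2 b2]
    unfolding eventually_at_right_field by blast
  have claim: "mu_bar K \<mu> A B Wstar x \<le> mu_loc l \<mu> \<eta> A B t \<and>
        mu_loc l \<mu> \<eta> A B t \<le> K_loc l K \<eta> A B t \<and>
        K_loc l K \<eta> A B t \<le> K_bar l K \<mu> A B Wstar x t \<and>
        loss l \<eta> A B (Suc t) \<le> loss l \<eta> A B t * rho l K \<mu> \<eta> A B t \<and>
        loss l \<eta> A B t * rho l K \<mu> \<eta> A B t
          \<le> loss l \<eta> A B t * rho_bar l K \<mu> A B Wstar x x 0 \<and>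
        loss l \<eta> A B (Suc t) \<le> loss l \<eta> A B 0 * rho_bar l K \<mu> A B Wstar x x 0 ^ (Suc t)"
    if x: "0 < x \<and> x < b"
      and step: "\<forall>t. x \<le> \<eta> t \<and>
        \<eta> t \<le> min ((1 + x\<^sup>2) powr (real t / 2) * x) (1 / K_loc l K \<eta> A B t)" for x \<eta> t
  proof -
    have steps: "x \<le> \<eta> t" "\<eta> t \<le> (1 + x\<^sup>2) powr (real t / 2) * x" "\<eta> t \<le> 1 / K_loc l K \<eta> A B t" for t
      using step by auto
    have bx: "0 \<le> mu_bar K \<mu> A B Wstar x" "0 \<le> rho_bar l K \<mu> A B Wstar x x 0"
      "rho_bar l K \<mu> A B Wstar x x 0 \<le> 1" "15 * K_bar l K \<mu> A B Wstar x 0 * x \<le> 2"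
      "\<And>t. 2 * (2 * K * factored_loss l A B * (exp (sqrt x) * alpha2 K \<mu> A B Wstar) * x\<^sup>2
         * (\<Sum>s<t. ((1 + x\<^sup>2) * rho_bar l K \<mu> A B Wstar x x 0) ^ s)) \<le> alpha2 K \<mu> A B Wstar * (exp (sqrt x) - 1)"
      using b(2)[of x] x by blast+
    show ?thesis
      by (intro conjI gd_invariant[OF assms(2,3) min assms(5) conjunct1[OF x] bx(1-3,5,4) steps])
  qed
  show ?thesis
    by (intro exI[of _ b] conjI[OF b(1)] allI impI) (rule claim)
qed

end
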